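(* Let $p_0,p_1\in(0,\infty)$ and let $w_0,w_1$ be weights on $(0,\infty)$. Define $\psi_0,\psi_1\colon(0,\infty)\to[0,\infty]$ by $$\psi_i(t)=\left(\int_t^\infty s^{-p_i}w_i(s)\,ds\right)^{\frac1{p_i}}\quad\text{for }t\in(0,\infty),\ i\in\{0,1\}.$$ Suppose that $\psi_i(0+)=\infty$ for $i\in\{0,1\}$; that there exists a positive constant $C$ such that $\psi_i(t)\le C\psi_i(2t)$ for all $t\in(0,\infty)$ and $i\in\{0,1\}$; and that $w_0\in\mathrm{RB}_{p_0}$, that is, there exists a positive constant $C'$ such that $$\int_0^t w_0(s)\,ds\le C'\,t^{p_0}\int_t^\infty\frac{w_0(s)}{s^{p_0}}\,ds\quad\text{for all }t\in(0,\infty).$$ Let $$\theta(t)=\frac{\psi_0(t)}{\psi_1(t)}\quad\text{for }t\in(0,\infty),$$ and assume that there exists $\varepsilon>0$ such that the function $t\mapsto\theta(t)\,\psi_0(t)^{\varepsilon}$ is equivalent to a non-decreasing function on $(0,\infty)$. Then $$K\big(f,\theta(t);S^{p_0}(w_0),S^{p_1}(w_1)\big)\approx\left(\int_0^t(f^{**}(s)-f^*(s))^{p_0}w_0(s)\,ds\right)^{\frac1{p_0}}+\theta(t)\left(\int_t^\infty(f^{**}(s)-f^*(s))^{p_1}w_1(s)\,ds\right)^{\frac1{p_1}}$$ for all $f\in S^{p_0}(w_0)+S^{p_1}(w_1)$ and $t\in(0,\infty)$, with constants in the relation $\approx$ independent of $f$ and $t$.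
   Context: $(\mathcal R,\mu)$ is a nonatomic $\sigma$-finite measure space with $\mu(\mathcal R)\in(0,\infty]$, over which the spaces below are considered. A weight on $(0,\infty)$ is a nonnegative measurable function on $(0,\infty)$. The non-increasing rearrangement of a measurable $f$ is $f^*(t)=\inf\{\lambda\ge0:\mu(\{|f|>\lambda\})\le t\}$, and $f^{**}(t)=\frac1t\int_0^tf^*(s)\,ds$. For $p\in(0,\infty)$ and a weight $w$, $\|f\|_{S^p(w)}=\left(\int_0^\infty(f^{**}(t)-f^*(t))^pw(t)\,dt\right)^{1/p}$, and $S^p(w)$ is the set of measurable $f$ on $\mathcal R$ with $\|f\|_{S^p(w)}<\infty$ and $\lim_{t\to\infty}f^*(t)=0$ (this functional need not be a quasinorm and the set need not be linear). $S^{p_0}(w_0)+S^{p_1}(w_1)$ is the set of $f$ that can be written as $f=f_0+f_1$ with $f_i\in S^{p_i}(w_i)$, and $K(f,t;X_0,X_1)=\inf\{\|f_0\|_{X_0}+t\|f_1\|_{X_1}: f=f_0+f_1,\ f_i\in X_i\}$. Two nonnegative functions are equivalent if each is bounded by a constant multiple of the other; $\approx$ has the same meaning for expressions.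
   Formalization: It is additionally assumed that ψ₁(t)<∞ for all t>0; otherwise ψ₁≡∞ by doubling, and θ is ∞/∞ or 0, where the claim is false (e.g. p₀=2, w₀=1, p₁=1, w₁(s)=s, f an indicator function). *)

theory Defs
  imports "HOL-Analysis.Analysis"
begin

definition nonatomic :: "'a measure \<Rightarrow> bool" where
  "nonatomic M \<longleftrightarrow> (\<forall>A\<in>sets M. 0 < emeasure M A \<longrightarrow>
     (\<exists>B\<in>sets M. B \<subseteq> A \<and> 0 < emeasure M B \<and> emeasure M B < emeasure M A))"

text \<open>Powers of extended nonnegative reals; used only with exponent \<open>a > 0\<close>, so that
  \<open>0\<close> and \<open>\<infinity>\<close> are mapped to themselves.\<close>
definition enn_powr :: "ennreal \<Rightarrow> real \<Rightarrow> ennreal" where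
  "enn_powr x a = (if x = top then top else ennreal (enn2real x powr a))"

text \<open>A weight on \<open>(0, \<infinity>)\<close>; values outside \<open>(0, \<infinity>)\<close> are never used, and the value
  \<open>\<infinity>\<close> is permitted.\<close>
definition weight :: "(real \<Rightarrow> ennreal) \<Rightarrow> bool" where
  "weight w \<longleftrightarrow> w \<in> borel_measurable (lebesgue_on {0<..})"

text \<open>The infimum is taken in \<open>[0, \<infinity>]\<close>, so it is \<open>\<infinity>\<close> over the empty set.\<close>
definition rearrangement :: "'a measure \<Rightarrow> ('a \<Rightarrow> real) \<Rightarrow> real \<Rightarrow> ennreal" where
  "rearrangement M f t =
     Inf {ennreal l | l. 0 \<le> l \<and> emeasure M {x \<in> space M. l < \<bar>f x\<bar>} \<le> ennreal t}"

definition max_rearrangement :: "'a measure \<Rightarrow> ('a \<Rightarrow> real) \<Rightarrow> real \<Rightarrow> ennreal" where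
  "max_rearrangement M f t =
     (\<integral>\<^sup>+ s \<in> {0<..<t}. rearrangement M f s \<partial>lebesgue) / ennreal t"

text \<open>The subtraction is the truncated one of \<open>ennreal\<close>. It is the ordinary difference whenever
  \<open>f\<^sup>*(t) < \<infinity>\<close>, because \<open>f\<^sup>* \<le> f\<^sup>*\<^sup>*\<close>; and \<open>f\<^sup>*\<close> is finite on \<open>(0, \<infinity>)\<close> for every real-valued
  measurable \<open>f\<close> with \<open>f\<^sup>*(\<infinity>) = 0\<close>.\<close>
definition osc :: "'a measure \<Rightarrow> ('a \<Rightarrow> real) \<Rightarrow> real \<Rightarrow> ennreal" where
  "osc M f t = max_rearrangement M f t - rearrangement M f t"

definition S_norm ::
    "'a measure \<Rightarrow> real \<Rightarrow> (real \<Rightarrow> ennreal) \<Rightarrow> ('a \<Rightarrow> real) \<Rightarrow> ennreal" where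
  "S_norm M p w f =
     enn_powr (\<integral>\<^sup>+ t \<in> {0<..}. enn_powr (osc M f t) p * w t \<partial>lebesgue) (1 / p)"

definition S_space :: "'a measure \<Rightarrow> real \<Rightarrow> (real \<Rightarrow> ennreal) \<Rightarrow> ('a \<Rightarrow> real) set" where
  "S_space M p w = {f \<in> borel_measurable M.
     S_norm M p w f < \<infinity> \<and> (rearrangement M f \<longlongrightarrow> 0) at_top}"

definition decomposes ::
    "'a measure \<Rightarrow> ('a \<Rightarrow> real) \<Rightarrow> ('a \<Rightarrow> real) \<Rightarrow> ('a \<Rightarrow> real) \<Rightarrow> bool" where
  "decomposes M f f0 f1 \<longleftrightarrow> (\<forall>x\<in>space M. f x = f0 x + f1 x)"

definition sum_space ::
    "'a measure \<Rightarrow> ('a \<Rightarrow> real) set \<Rightarrow> ('a \<Rightarrow> real) set \<Rightarrow> ('a \<Rightarrow> real) set" where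
  "sum_space M X0 X1 = {f. \<exists>f0\<in>X0. \<exists>f1\<in>X1. decomposes M f f0 f1}"

definition S_K_functional ::
    "'a measure \<Rightarrow> real \<Rightarrow> (real \<Rightarrow> ennreal) \<Rightarrow> real \<Rightarrow> (real \<Rightarrow> ennreal) \<Rightarrow>
      ('a \<Rightarrow> real) \<Rightarrow> ennreal \<Rightarrow> ennreal" where
  "S_K_functional M p0 w0 p1 w1 f t =
     Inf {S_norm M p0 w0 f0 + t * S_norm M p1 w1 f1 | f0 f1.
       f0 \<in> S_space M p0 w0 \<and> f1 \<in> S_space M p1 w1 \<and> decomposes M f f0 f1}"

definition equivalent_on :: "'b set \<Rightarrow> ('b \<Rightarrow> ennreal) \<Rightarrow> ('b \<Rightarrow> ennreal) \<Rightarrow> bool" where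
  "equivalent_on A g h \<longleftrightarrow>
     (\<exists>C::real. C > 0 \<and> (\<forall>x\<in>A. g x \<le> ennreal C * h x \<and> h x \<le> ennreal C * g x))"

definition psi :: "real \<Rightarrow> (real \<Rightarrow> ennreal) \<Rightarrow> real \<Rightarrow> ennreal" where
  "psi p w t = enn_powr (\<integral>\<^sup>+ s \<in> {t<..}. ennreal (s powr (- p)) * w s \<partial>lebesgue) (1 / p)"

definition RB :: "real \<Rightarrow> (real \<Rightarrow> ennreal) \<Rightarrow> bool" where
  "RB p w \<longleftrightarrow> (\<exists>C::real. C > 0 \<and> (\<forall>t>0.
     (\<integral>\<^sup>+ s \<in> {0<..<t}. w s \<partial>lebesgue) \<le>
       ennreal C * ennreal (t powr p) * (\<integral>\<^sup>+ s \<in> {t<..}. w s / ennreal (s powr p) \<partial>lebesgue)))"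

text \<open>In \<open>ennreal\<close> a quotient with denominator \<open>\<infinity>\<close> is \<open>0\<close>, including \<open>\<infinity> / \<infinity>\<close>.\<close>
definition theta ::
    "real \<Rightarrow> (real \<Rightarrow> ennreal) \<Rightarrow> real \<Rightarrow> (real \<Rightarrow> ennreal) \<Rightarrow> real \<Rightarrow> ennreal" where
  "theta p0 w0 p1 w1 t = psi p0 w0 t / psi p1 w1 t"

end

theory Submission
  imports Defs
begin

text \<open>
  Put \<open>G\<^sub>f(t) = t (f\<^sup>*\<^sup>*(t) - f\<^sup>*(t)) = \<integral>\<^sub>0\<^sup>t (f\<^sup>* - f\<^sup>*(t))\<close>, which is nondecreasing, so that
  \<open>G\<^sub>f(t) \<psi>(t) \<le> \<parallel>f\<parallel>\<close>.

  For the upper bound, cut \<open>f\<close> at the height \<open>f\<^sup>*(t)\<close>. Then \<open>G\<close> of the upper part is \<open>G\<^sub>f(min s t)\<close>,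
  \<open>G\<close> of the lower part vanishes before \<open>t\<close> and is at most \<open>G\<^sub>f\<close> after it, and the remaining term
  \<open>G\<^sub>f(t) \<psi>\<^sub>0(t) = \<theta>(t) G\<^sub>f(t) \<psi>\<^sub>1(t)\<close> is absorbed by the second integral.

  For the lower bound, \<open>G\<^sub>f(t) \<le> 3 \<integral>\<^sub>0\<^sup>t f\<^sub>0\<^sup>* + 2 G(2t)\<close> whenever \<open>f = f\<^sub>0 + f\<^sub>1\<close>, where \<open>G\<close> on the right
  belongs to \<open>f\<^sub>1\<close>. The class \<open>RB\<close> is self-improving, which yields a Hardy inequality bounding
  \<open>f\<^sub>0\<^sup>*\<^sup>*\<close> by \<open>f\<^sub>0\<^sup>*\<^sup>* - f\<^sub>0\<^sup>*\<close> in the weighted norm; doubling of \<open>\<psi>\<^sub>1\<close> removes the dilation; and the two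
  cross terms are estimated by the pointwise bounds \<open>1 / \<psi>\<^sub>i\<close>, which are integrable with the right
  size because \<open>\<theta> \<psi>\<^sub>0\<^sup>\<epsilon>\<close> is essentially nondecreasing.
\<close>

section \<open>Powers of extended nonnegative reals and tails of weights\<close>

text \<open>The exponents may lie below 1 and the functional is not a norm, so neither Minkowski's
  inequality nor linearity is available. Everything is reduced to weighted integrals of
  nondecreasing functions: with v(s) = s^(-p) w(s) the p-th power of the norm is the integral of G^p
  v, and \<psi>^p is the tail of v. A nondecreasing integrand sees v only through its tails, so
  doubling and RB are used as statements about tails. The obstacle in the lower bound is that the
  oscillation is not subadditive, even up to dilations: of the two summands only one can keep its
  oscillation. The other, f0, enters with its full mass, which exceeds its oscillation; this is why
  RB is asked of w0 and why a Hardy inequality is needed. The role of \<epsilon> is to move off a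
  borderline: monotonicity of \<theta> alone would leave a logarithmically divergent integral of du
  / u in the cross terms, whereas the extra power of \<psi>0 produces the exponents 1 + \<epsilon>
  near 0 and 1 / (1 + \<epsilon>) near infinity.\<close>

lemma enn_powr_mono: "0 < p \<Longrightarrow> x \<le> y \<Longrightarrow> enn_powr x p \<le> enn_powr y p"
  by (cases x; cases y) (auto simp: enn_powr_def top_unique intro!: powr_mono2)

lemma enn_powr_0 [simp]: "enn_powr 0 p = 0"
  by (simp add: enn_powr_def)

lemma enn_powr_ennreal: "0 \<le> a \<Longrightarrow> enn_powr (ennreal a) p = ennreal (a powr p)"
  by (simp add: enn_powr_def)

lemma enn_powr_mult: "0 < p \<Longrightarrow> enn_powr (x * y) p = enn_powr x p * enn_powr y p"
  by (cases x; cases y)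
    (auto simp: enn_powr_def ennreal_mult_top ennreal_top_mult powr_mult ennreal_mult ennreal_mult_eq_top_iff enn2real_mult)

lemma enn_powr_powr_inverse: "0 < p \<Longrightarrow> enn_powr (enn_powr x p) (1 / p) = x"
  by (cases x) (auto simp: enn_powr_def powr_powr)

lemma enn_powr_inverse_powr: "0 < p \<Longrightarrow> enn_powr (enn_powr x (1 / p)) p = x"
  by (cases x) (auto simp: enn_powr_def powr_powr)

text \<open>Comparing the sum with twice the larger summand gives the constant 2^p for every p > 0,
  so p < 1 and p \<ge> 1 never have to be separated.\<close>

lemma enn_powr_add_le:
  assumes "0 < p"
  shows "enn_powr (x + y) p \<le> ennreal (2 powr p) * (enn_powr x p + enn_powr y p)"
proof -
  have "enn_powr (x + y) p \<le> enn_powr (ennreal 2 * max x y) p"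
    using assms by (intro enn_powr_mono) (auto simp: mult_2 intro!: add_mono)
  also have "\<dots> = ennreal (2 powr p) * enn_powr (max x y) p"
    using assms by (simp only: enn_powr_mult enn_powr_ennreal)
  also have "enn_powr (max x y) p \<le> enn_powr x p + enn_powr y p"
    by (auto simp: max_def add_increasing)
  finally show ?thesis by (simp add: mult_left_mono)
qed

lemma borel_measurable_enn_powr [measurable (raw)]:
  assumes [measurable]: "f \<in> borel_measurable M"
  shows "(\<lambda>x. enn_powr (f x) p) \<in> borel_measurable M"
  unfolding enn_powr_def by measurable

lemma borel_measurable_ennreal_mono:
  fixes F :: "real \<Rightarrow> ennreal"
  assumes "mono F"
  shows "F \<in> borel_measurable borel"
proof (rule borel_measurableI_greater)
  fix y
  have "is_interval {x. y < F x}"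
    unfolding is_interval_1 using assms by (auto simp: mono_def intro: less_le_trans)
  then show "{x \<in> space borel. y < F x} \<in> sets borel"
    by (simp add: real_interval_borel_measurable)
qed

lemma borel_measurable_ennreal_antimono:
  fixes F :: "real \<Rightarrow> ennreal"
  assumes "antimono F"
  shows "F \<in> borel_measurable borel"
proof (rule borel_measurableI_greater)
  fix y
  have "is_interval {x. y < F x}"
    unfolding is_interval_1 using assms by (auto simp: antimono_def intro: less_le_trans)
  then show "{x \<in> space borel. y < F x} \<in> sets borel"
    by (simp add: real_interval_borel_measurable)
qed

lemma borel_measurable_lebesgue_if_borel [measurable (raw)]:
  "f \<in> borel_measurable borel \<Longrightarrow> f \<in> borel_measurable lebesgue"
  by (simp add: measurable_completion)

text \<open>For v(s) = s^(-p) w(s) on (0, \<infinity>) this is the p-th power of \<open>psi\<close>.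
  A general v lets the estimates for the two weights share their proofs.\<close>

definition tail :: "(real \<Rightarrow> ennreal) \<Rightarrow> real \<Rightarrow> ennreal" where
  "tail v a = (\<integral>\<^sup>+ s \<in> {a<..}. v s \<partial>lebesgue)"

lemma tail_antimono: "antimono (tail v)"
  unfolding tail_def
  by (intro antimonoI nn_integral_mono) (auto split: split_indicator)

lemma tail_mono: "a \<le> b \<Longrightarrow> tail v b \<le> tail v a"
  using tail_antimono by (auto simp: antimono_def)

lemma borel_measurable_tail [measurable]: "tail v \<in> borel_measurable borel"
  by (intro borel_measurable_ennreal_antimono tail_antimono)

text \<open>The half-lines to the right of a + 1/(n+1) increase to the open half-line to the right
  of a, so monotone convergence transfers the bound. This settles endpoints at which a bound is not
  directly available.\<close>

lemma tail_le_of_right: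
  assumes [measurable]: "v \<in> borel_measurable lebesgue" and le: "\<And>b. a < b \<Longrightarrow> tail v b \<le> x"
  shows "tail v a \<le> x"
proof -
  let ?g = "\<lambda>n s. v s * indicator {a + 1 / real (Suc n)<..} s"
  have "(SUP n. ?g n s) = v s * indicator {a<..} s" for s
  proof (cases "a < s")
    case True
    then obtain n where "1 / real (Suc n) < s - a"
      using nat_approx_posE[of "s - a"] by auto
    then have "?g n s = v s" by (auto simp: indicator_def)
    then have "v s \<le> (SUP n. ?g n s)" using SUP_upper[of n UNIV "\<lambda>n. ?g n s"] by auto
    moreover have "(SUP n. ?g n s) \<le> v s" by (intro SUP_least) (auto simp: indicator_def)
    ultimately show ?thesis using True by simp
  next
    case False
    then have "\<not> a + 1 / real (Suc n) < s" for n
      using divide_nonneg_nonneg[of 1 "real (Suc n)"] by linarith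
    with False show ?thesis by (simp add: indicator_def)
  qed
  then have "tail v a = (\<integral>\<^sup>+ s. (SUP n. ?g n s) \<partial>lebesgue)"
    unfolding tail_def by simp
  also have "\<dots> = (SUP n. tail v (a + 1 / real (Suc n)))"
    unfolding tail_def
  proof (rule nn_integral_monotone_convergence_SUP)
    have "1 / real (Suc n) \<le> 1 / real (Suc m)" if "m \<le> n" for m n
      using that by (simp add: frac_le)
    then show "incseq ?g"
      by (force simp: incseq_def le_fun_def split: split_indicator)
  qed measurable
  also have "\<dots> \<le> x"
    by (intro SUP_least le) simp
  finally show ?thesis .
qed

section \<open>Level sets of a tail and integrals of its negative powers\<close>

lemma nn_integral_atLeast_eq_tail:
  "(\<integral>\<^sup>+ s \<in> {a..}. v s \<partial>lebesgue) = tail v a"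
  unfolding tail_def
proof (rule nn_integral_cong_AE)
  have "AE s in lebesgue. s \<noteq> a"
    by (rule AE_completion) (rule AE_lborel_singleton)
  then show "AE s in lebesgue. v s * indicator {a..} s = v s * indicator {a<..} s"
    by eventually_elim (auto split: split_indicator)
qed

text \<open>The tail is antimonotone, so the level set is a half-line, up to its left endpoint a.
  The tail at a itself need not be below x, but all tails strictly to the right are, and right
  continuity gives the nonstrict bound.\<close>

lemma nn_integral_level_set_le:
  assumes [measurable]: "v \<in> borel_measurable lebesgue"
  shows "(\<integral>\<^sup>+ s \<in> {s. 0 < s \<and> tail v s < x}. v s \<partial>lebesgue) \<le> x"
proof (cases "{s. 0 < s \<and> tail v s < x} = {}")
  case False
  let ?U = "{s. 0 < s \<and> tail v s < x}"
  define a where "a = Inf ?U"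
  have bdd: "bdd_below ?U" by (auto intro!: bdd_belowI[of _ 0])
  have "(\<integral>\<^sup>+ s \<in> ?U. v s \<partial>lebesgue) \<le> (\<integral>\<^sup>+ s \<in> {a..}. v s \<partial>lebesgue)"
    using bdd by (intro nn_integral_mono) (auto simp: a_def split: split_indicator intro: cInf_lower)
  also have "\<dots> = tail v a" by (rule nn_integral_atLeast_eq_tail)
  also have "\<dots> \<le> x"
  proof (rule tail_le_of_right)
    fix b assume "a < b"
    then obtain c where "c \<in> ?U" "c < b"
      using False bdd unfolding a_def by (meson cInf_less_iff)
    then show "tail v b \<le> x"
      using tail_mono[of c b v] by auto
  qed measurable
  finally show ?thesis .
qed simp

text \<open>Decomposing dyadically by the size of the tail replaces the substitution \<open>u = tail v s\<close>.\<close>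

lemma nn_integral_powr_tail_le:
  fixes c :: "nat \<Rightarrow> real"
  assumes [measurable]: "v \<in> borel_measurable lebesgue" and "0 \<le> \<beta>" and c: "\<And>k. 0 < c k"
    and A: "\<And>s. s \<in> A \<Longrightarrow> 0 < s \<and> (\<exists>k. ennreal (c k) \<le> tail v s \<and> tail v s < ennreal (2 * c k))"
  shows "(\<integral>\<^sup>+ s \<in> A. ennreal (enn2real (tail v s) powr (- \<beta>)) * v s \<partial>lebesgue)
      \<le> (\<Sum>k. ennreal (2 * c k powr (1 - \<beta>)))"
proof -
  \<comment> \<open>Overcounting is harmless: the k-th summand lives on the whole level set below 2
    c(k), whose v-mass is at most 2 c(k), and a point of \<open>A\<close> only has to fall into at
    least one dyadic shell.\<close>
  let ?g = "\<lambda>k s. ennreal (c k powr (- \<beta>)) * (v s * indicator {s. 0 < s \<and> tail v s < ennreal (2 * c k)} s)"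
  have "(\<integral>\<^sup>+ s \<in> A. ennreal (enn2real (tail v s) powr (- \<beta>)) * v s \<partial>lebesgue)
      \<le> (\<integral>\<^sup>+ s. (\<Sum>k. ?g k s) \<partial>lebesgue)"
  proof (rule nn_integral_mono)
    fix s
    show "ennreal (enn2real (tail v s) powr (- \<beta>)) * v s * indicator A s \<le> (\<Sum>k. ?g k s)"
    proof (cases "s \<in> A")
      case True
      then obtain k where k: "ennreal (c k) \<le> tail v s" "tail v s < ennreal (2 * c k)" and "0 < s"
        using A by blast
      have "c k \<le> enn2real (tail v s)"
        using k c[of k] by (cases "tail v s") auto
      then have "enn2real (tail v s) powr (- \<beta>) \<le> c k powr (- \<beta>)"
        using c[of k] \<open>0 \<le> \<beta>\<close> by (intro powr_mono2') auto
      then have "ennreal (enn2real (tail v s) powr (- \<beta>)) * v s * indicator A s \<le> ?g k s"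
        using True k \<open>0 < s\<close> by (auto intro!: mult_right_mono ennreal_leI)
      also have "?g k s = (\<Sum>k\<in>{k}. ?g k s)" by simp
      also have "\<dots> \<le> (\<Sum>k. ?g k s)" by (rule sum_le_suminf) auto
      finally show ?thesis .
    qed simp
  qed
  also have "\<dots> = (\<Sum>k. \<integral>\<^sup>+ s. ?g k s \<partial>lebesgue)"
    by (rule nn_integral_suminf) measurable
  also have "\<dots> = (\<Sum>k. ennreal (c k powr (- \<beta>)) *
      (\<integral>\<^sup>+ s \<in> {s. 0 < s \<and> tail v s < ennreal (2 * c k)}. v s \<partial>lebesgue))"
    by (intro suminf_cong nn_integral_cmult) measurable
  also have "\<dots> \<le> (\<Sum>k. ennreal (2 * c k powr (1 - \<beta>)))"
  proof (intro suminf_le)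
    fix k
    have "ennreal (c k powr (- \<beta>)) *
        (\<integral>\<^sup>+ s \<in> {s. 0 < s \<and> tail v s < ennreal (2 * c k)}. v s \<partial>lebesgue)
        \<le> ennreal (c k powr (- \<beta>)) * ennreal (2 * c k)"
      by (intro mult_left_mono nn_integral_level_set_le) auto
    also have "\<dots> = ennreal (2 * c k powr (1 - \<beta>))"
      using c[of k] by (subst ennreal_mult[symmetric]) (auto simp: powr_diff powr_minus field_simps)
    finally show "ennreal (c k powr (- \<beta>)) *
        (\<integral>\<^sup>+ s \<in> {s. 0 < s \<and> tail v s < ennreal (2 * c k)}. v s \<partial>lebesgue)
        \<le> ennreal (2 * c k powr (1 - \<beta>))" .
  qed auto
  finally show ?thesis .
qed

lemma exists_dyadic_ge:
  fixes x :: real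
  assumes "1 \<le> x"
  shows "\<exists>k. 2 ^ k \<le> x \<and> x < 2 * 2 ^ k"
proof -
  define n where "n = (LEAST n. x < 2 ^ n)"
  have "\<exists>n. x < 2 ^ n" using real_arch_pow[of 2 x] by auto
  then have n: "x < 2 ^ n" unfolding n_def by (rule LeastI_ex)
  then obtain k where k: "n = Suc k" using assms by (cases n) auto
  then have "\<not> x < 2 ^ k" using not_less_Least[of k "\<lambda>n. x < 2 ^ n"] n_def by simp
  with n k show ?thesis by (intro exI[of _ k]) auto
qed

lemma exists_dyadic_le:
  fixes x :: real
  assumes "0 < x" "x \<le> 1"
  shows "\<exists>k. (1 / 2) ^ k \<le> x \<and> x < 2 * (1 / 2) ^ k"
proof -
  define n where "n = (LEAST n. (1 / 2) ^ n \<le> x)"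
  have "\<exists>n. (1 / 2) ^ n \<le> x" using real_arch_pow_inv[of x "1/2"] assms by (auto intro: less_imp_le)
  then have n: "(1 / 2) ^ n \<le> x" unfolding n_def by (rule LeastI_ex)
  show ?thesis
  proof (cases n)
    case 0
    then show ?thesis using n assms by (intro exI[of _ 0]) auto
  next
    case (Suc k)
    then have "\<not> (1 / 2) ^ k \<le> x" using not_less_Least[of k "\<lambda>n. (1 / 2) ^ n \<le> x"] n_def by simp
    with n Suc show ?thesis by (intro exI[of _ n]) auto
  qed
qed

lemma suminf_ennreal_geometric:
  fixes r a :: real
  assumes "0 \<le> r" "r < 1" "0 \<le> a"
  shows "(\<Sum>k. ennreal (a * r ^ k)) = ennreal (a / (1 - r))"
proof (rule suminf_ennreal_eq)
  show "(\<lambda>k. a * r ^ k) sums (a / (1 - r))"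
    using sums_mult[OF geometric_sums[of r], of a] assms by simp
qed (use assms in auto)

text \<open>With u = tail v s this is the integral of u^(-1-\<epsilon>) over u \<ge> tail v t. The
  shells at the scales 2^k tail v t cover (0, t), and the k-th contributes a multiple of 2^(-k
  \<epsilon>). Finiteness of the tails makes \<open>enn2real\<close> faithful.\<close>

lemma nn_integral_powr_tail_near_0:
  assumes [measurable]: "v \<in> borel_measurable lebesgue" and "0 < \<epsilon>" and "0 < t"
    and pos: "0 < tail v t" and fin: "\<And>s. 0 < s \<Longrightarrow> tail v s < \<infinity>"
  shows "(\<integral>\<^sup>+ s \<in> {0<..<t}. ennreal (enn2real (tail v s) powr (- (1 + \<epsilon>))) * v s \<partial>lebesgue)
      \<le> ennreal (2 / (1 - 2 powr (- \<epsilon>)) * enn2real (tail v t) powr (- \<epsilon>))"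
proof -
  let ?b = "enn2real (tail v t)"
  have b: "0 < ?b" using pos fin[OF \<open>0 < t\<close>] by (simp add: enn2real_positive_iff)
  have "(\<integral>\<^sup>+ s \<in> {0<..<t}. ennreal (enn2real (tail v s) powr (- (1 + \<epsilon>))) * v s \<partial>lebesgue)
      \<le> (\<Sum>k. ennreal (2 * (2 ^ k * ?b) powr (1 - (1 + \<epsilon>))))"
  proof (rule nn_integral_powr_tail_le)
    fix s assume s: "s \<in> {0<..<t}"
    define x where "x = enn2real (tail v s)"
    have x: "tail v s = ennreal x" "0 \<le> x" using fin[of s] s by (auto simp: x_def)
    have "?b \<le> x" unfolding x_def using s fin[of s] by (intro enn2real_mono tail_mono) auto
    then obtain k where "2 ^ k \<le> x / ?b \<and> x / ?b < 2 * 2 ^ k"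
      using exists_dyadic_ge[of "x / ?b"] b by auto
    then have "2 ^ k * ?b \<le> x \<and> x < 2 * (2 ^ k * ?b)" using b by (simp add: field_simps)
    then show "0 < s \<and> (\<exists>k. ennreal (2 ^ k * ?b) \<le> tail v s \<and> tail v s < ennreal (2 * (2 ^ k * ?b)))"
      using s x b by (auto simp: ennreal_less_iff intro!: exI[of _ k] simp del: ennreal_enn2real)
  qed (use b \<open>0 < \<epsilon>\<close> in auto)
  also have "\<dots> = (\<Sum>k. ennreal ((2 * ?b powr (- \<epsilon>)) * (2 powr (- \<epsilon>)) ^ k))"
  proof (intro suminf_cong arg_cong[where f = ennreal])
    fix k :: nat
    have "(2 ^ k) powr (- \<epsilon>) = (2 powr (- \<epsilon>)) ^ k" for \<epsilon> :: real
      by (simp add: powr_realpow[symmetric] powr_powr mult.commute)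
    then show "2 * (2 ^ k * ?b) powr (1 - (1 + \<epsilon>)) = (2 * ?b powr (- \<epsilon>)) * (2 powr (- \<epsilon>)) ^ k"
      using b by (simp add: powr_mult)
  qed
  also have "\<dots> = ennreal ((2 * ?b powr (- \<epsilon>)) / (1 - 2 powr (- \<epsilon>)))"
    using \<open>0 < \<epsilon>\<close> by (intro suminf_ennreal_geometric) (auto simp: powr_less_one)
  finally show ?thesis by simp
qed

text \<open>The mirror image: the integral of u^(-\<alpha>) over 0 < u \<le> tail v t, which
  converges because \<alpha> < 1. The scales now decrease, and the shells contribute a geometric
  series of ratio 2^(\<alpha> - 1).\<close>

lemma nn_integral_powr_tail_near_infinity:
  assumes [measurable]: "v \<in> borel_measurable lebesgue" and "0 < \<alpha>" "\<alpha> < 1" and "0 < t"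
    and fin: "tail v t < \<infinity>" and pos: "\<And>s. 0 < s \<Longrightarrow> 0 < tail v s"
  shows "(\<integral>\<^sup>+ s \<in> {t<..}. ennreal (enn2real (tail v s) powr (- \<alpha>)) * v s \<partial>lebesgue)
      \<le> ennreal (2 / (1 - 2 powr (\<alpha> - 1)) * enn2real (tail v t) powr (1 - \<alpha>))"
proof -
  let ?b = "enn2real (tail v t)"
  have b: "0 < ?b" using pos[OF \<open>0 < t\<close>] fin by (simp add: enn2real_positive_iff)
  have "(\<integral>\<^sup>+ s \<in> {t<..}. ennreal (enn2real (tail v s) powr (- \<alpha>)) * v s \<partial>lebesgue)
      \<le> (\<Sum>k. ennreal (2 * ((1 / 2) ^ k * ?b) powr (1 - \<alpha>)))"
  proof (rule nn_integral_powr_tail_le)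
    fix s assume s: "s \<in> {t<..}"
    define x where "x = enn2real (tail v s)"
    have le: "tail v s \<le> tail v t" using s by (intro tail_mono) auto
    have x: "tail v s = ennreal x" "0 < x"
      using pos[of s] fin le s \<open>0 < t\<close> by (auto simp: x_def enn2real_positive_iff)
    have "x \<le> ?b" unfolding x_def using fin le by (intro enn2real_mono) auto
    then obtain k where "(1 / 2) ^ k \<le> x / ?b \<and> x / ?b < 2 * (1 / 2) ^ k"
      using exists_dyadic_le[of "x / ?b"] b x by auto
    then have "(1 / 2) ^ k * ?b \<le> x \<and> x < 2 * ((1 / 2) ^ k * ?b)" using b
      by (metis mult.assoc pos_divide_less_eq pos_le_divide_eq)
    then show "0 < s \<and> (\<exists>k. ennreal ((1 / 2) ^ k * ?b) \<le> tail v s \<and> tail v s < ennreal (2 * ((1 / 2) ^ k * ?b)))"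
      using s x b \<open>0 < t\<close> by (auto simp: ennreal_less_iff intro!: exI[of _ k] simp del: ennreal_enn2real)
  qed (use b \<open>0 < \<alpha>\<close> in auto)
  also have "\<dots> = (\<Sum>k. ennreal ((2 * ?b powr (1 - \<alpha>)) * (2 powr (\<alpha> - 1)) ^ k))"
  proof (intro suminf_cong arg_cong[where f = ennreal])
    fix k :: nat
    have "((1 / 2) ^ k) powr (1 - \<alpha>) = (2 powr (\<alpha> - 1)) ^ k"
      by (simp add: powr_realpow[symmetric] powr_powr powr_divide powr_minus_divide[symmetric] algebra_simps)
    then show "2 * ((1 / 2) ^ k * ?b) powr (1 - \<alpha>) = (2 * ?b powr (1 - \<alpha>)) * (2 powr (\<alpha> - 1)) ^ k"
      using b by (simp add: powr_mult)
  qed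
  also have "\<dots> = ennreal ((2 * ?b powr (1 - \<alpha>)) / (1 - 2 powr (\<alpha> - 1)))"
    using \<open>\<alpha> < 1\<close> by (intro suminf_ennreal_geometric) (auto simp: powr_less_one)
  finally show ?thesis by simp
qed

section \<open>Layer cake formula and dilations of monotone integrands\<close>

lemma sigma_finite_measure_lebesgue: "sigma_finite_measure (lebesgue :: 'b::euclidean_space measure)"
proof
  obtain A :: "'b set set" where "countable A" "A \<subseteq> sets lborel" "\<Union>A = space lborel"
    "\<forall>a\<in>A. emeasure lborel a \<noteq> \<infinity>"
    using lborel.sigma_finite_countable by blast
  then show "\<exists>A::'b set set. countable A \<and> A \<subseteq> sets lebesgue \<and> \<Union>A = space lebesgue \<and>
      (\<forall>a\<in>A. emeasure lebesgue a \<noteq> \<infinity>)"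
    by (intro exI[of _ A]) (auto simp: subset_iff)
qed

lemma ennreal_eq_nn_integral_level:
  fixes x :: ennreal
  shows "x = (\<integral>\<^sup>+ l. indicator {l. 0 \<le> l \<and> ennreal l < x} l \<partial>lborel)"
proof (cases x)
  case (real r)
  then have "{l. 0 \<le> l \<and> ennreal l < x} = {0..<r}" by (auto simp: ennreal_less_iff)
  with real show ?thesis by simp
next
  case top
  then have "{l. 0 \<le> l \<and> ennreal l < x} = {0..}" by auto
  moreover have "emeasure lborel {0::real..} = top"
  proof (rule ccontr)
    assume "emeasure lborel {0::real..} \<noteq> top"
    then obtain n where "emeasure lborel {0::real..} < of_nat n"
      using ennreal_Ex_less_of_nat by (auto simp: less_top)
    moreover have "of_nat n = emeasure lborel {0..real n}"
      by (simp add: ennreal_of_nat_eq_real_of_nat)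
    moreover have "emeasure lborel {0..real n} \<le> emeasure lborel {0::real..}"
      by (intro emeasure_mono) auto
    ultimately show False by (simp add: not_less[symmetric])
  qed
  ultimately show ?thesis using top by simp
qed

text \<open>Layer cake: the superlevel sets of a monotone function are half-lines, so it suffices to compare tails.\<close>

lemma nn_integral_mono_dilation_le:
  fixes F v :: "real \<Rightarrow> ennreal"
  assumes F: "mono F" and [measurable]: "v \<in> borel_measurable lebesgue" and "0 < c"
    and le: "\<And>a. 0 < a \<Longrightarrow> tail v (a / c) \<le> A * tail v a"
  shows "(\<integral>\<^sup>+ s \<in> {0<..}. F (c * s) * v s \<partial>lebesgue) \<le> A * (\<integral>\<^sup>+ s \<in> {0<..}. F s * v s \<partial>lebesgue)"
proof -
  have F_borel: "F \<in> borel_measurable borel" by (rule borel_measurable_ennreal_mono[OF F])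
  then have [measurable]: "F \<in> borel_measurable lebesgue" by measurable
  \<comment> \<open>The hypothesis speaks only of a > 0. The value a = 0 occurs when a superlevel
    set fills (0, \<infinity>), and it is reached from the right.\<close>
  have le0: "tail v 0 \<le> A * tail v 0"
  proof (rule tail_le_of_right)
    fix b :: real assume "0 < b"
    then have "tail v b \<le> A * tail v (c * b)" using le[of "c * b"] \<open>0 < c\<close> by simp
    also have "\<dots> \<le> A * tail v 0" using \<open>0 < b\<close> \<open>0 < c\<close> by (intro mult_left_mono tail_mono) auto
    finally show "tail v b \<le> A * tail v 0" .
  qed measurable
  have layer: "(\<integral>\<^sup>+ s \<in> {0<..}. H s * v s \<partial>lebesgue) =
      (\<integral>\<^sup>+ l. (\<integral>\<^sup>+ s. v s * indicator {s. 0 < s \<and> 0 \<le> l \<and> ennreal l < H s} s \<partial>lebesgue) \<partial>lborel)"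
    if [measurable]: "H \<in> borel_measurable lebesgue" for H :: "real \<Rightarrow> ennreal"
  proof -
    have "H s * v s * indicator {0<..} s =
        (\<integral>\<^sup>+ l. v s * indicator {s. 0 < s \<and> 0 \<le> l \<and> ennreal l < H s} s \<partial>lborel)" for s
    proof -
      have "(\<integral>\<^sup>+ l. v s * indicator {s. 0 < s \<and> 0 \<le> l \<and> ennreal l < H s} s \<partial>lborel) =
        (\<integral>\<^sup>+ l. v s * indicator {0<..} s * indicator {l. 0 \<le> l \<and> ennreal l < H s} l \<partial>lborel)"
        by (intro nn_integral_cong) (auto split: split_indicator)
      also have "\<dots> = v s * indicator {0<..} s * H s"
        by (subst nn_integral_cmult, measurable) (simp add: ennreal_eq_nn_integral_level[symmetric])
      finally show ?thesis by (simp add: mult_ac)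
    qed
    then have "(\<integral>\<^sup>+ s \<in> {0<..}. H s * v s \<partial>lebesgue) = (\<integral>\<^sup>+ s. (\<integral>\<^sup>+ l. v s *
        indicator {s. 0 < s \<and> 0 \<le> l \<and> ennreal l < H s} s \<partial>lborel) \<partial>lebesgue)"
      by simp
    \<comment> \<open>Fubini's theorem with the Lebesgue measure in s, since v is only Lebesgue
      measurable; for the level l the measure \<open>lborel\<close> suffices.\<close>
    also have "\<dots> = (\<integral>\<^sup>+ l. (\<integral>\<^sup>+ s. v s *
        indicator {s. 0 < s \<and> 0 \<le> l \<and> ennreal l < H s} s \<partial>lebesgue) \<partial>lborel)"
    proof -
      interpret pair_sigma_finite lebesgue "lborel :: real measure"
        by (intro pair_sigma_finite.intro sigma_finite_measure_lebesgue
            lborel.sigma_finite_measure_axioms)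
      show ?thesis
        by (rule Fubini'[symmetric]) measurable
    qed
    finally show ?thesis .
  qed
  have "(\<integral>\<^sup>+ s \<in> {0<..}. F (c * s) * v s \<partial>lebesgue) =
      (\<integral>\<^sup>+ l. (\<integral>\<^sup>+ s. v s * indicator {s. 0 < s \<and> 0 \<le> l \<and> ennreal l < F (c * s)} s \<partial>lebesgue) \<partial>lborel)"
    by (rule layer[OF borel_measurable_lebesgue_if_borel[OF measurable_compose[OF _ F_borel]]]) measurable
  also have "\<dots> \<le> (\<integral>\<^sup>+ l. A * (\<integral>\<^sup>+ s. v s * indicator {s. 0 < s \<and> 0 \<le> l \<and> ennreal l < F s} s \<partial>lebesgue) \<partial>lborel)"
  proof (rule nn_integral_mono)
    fix l :: real
    define U where "U = {s. 0 < s \<and> 0 \<le> l \<and> ennreal l < F s}"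
    have up: "s' \<in> U" if "s \<in> U" "s \<le> s'" for s s'
      using that F unfolding U_def by (auto simp: mono_def intro: less_le_trans)
    have U0: "0 < s" if "s \<in> U" for s using that by (simp add: U_def)
    have bdd: "bdd_below U" by (auto simp: U_def intro!: bdd_belowI[of _ 0])
    have V: "{s. 0 < s \<and> 0 \<le> l \<and> ennreal l < F (c * s)} = {s. c * s \<in> U}"
      using \<open>0 < c\<close> by (auto simp: U_def zero_less_mult_iff)
    have "(\<integral>\<^sup>+ s \<in> {s. c * s \<in> U}. v s \<partial>lebesgue) \<le> A * (\<integral>\<^sup>+ s \<in> U. v s \<partial>lebesgue)"
    proof (cases "U = {}")
      case False
      define a where "a = Inf U"
      have a0: "0 \<le> a" unfolding a_def using False by (intro cInf_greatest) (auto dest: U0)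
      \<comment> \<open>The superlevel set lies between the open and the closed half-line at a.
        These have the same v-integral, so it does not matter whether a belongs to it.\<close>
      have sub: "{a<..} \<subseteq> U"
      proof
        fix s assume "s \<in> {a<..}"
        then obtain u where "u \<in> U" "u < s"
          using False bdd unfolding a_def by (auto simp: cInf_less_iff)
        then show "s \<in> U" by (intro up[of u s]) auto
      qed
      have "{s. c * s \<in> U} \<subseteq> {a / c..}"
        using bdd \<open>0 < c\<close> by (auto simp: a_def divide_le_eq mult.commute intro: cInf_lower)
      then have "(\<integral>\<^sup>+ s \<in> {s. c * s \<in> U}. v s \<partial>lebesgue) \<le> (\<integral>\<^sup>+ s \<in> {a / c..}. v s \<partial>lebesgue)"
        by (intro nn_integral_mono) (auto split: split_indicator)
      also have "\<dots> = tail v (a / c)" by (rule nn_integral_atLeast_eq_tail)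
      also have "\<dots> \<le> A * tail v a" using le[of a] le0 a0 by (cases "a = 0") auto
      also have "\<dots> \<le> A * (\<integral>\<^sup>+ s \<in> U. v s \<partial>lebesgue)"
        unfolding tail_def using sub
        by (intro mult_left_mono nn_integral_mono) (auto split: split_indicator)
      finally show ?thesis .
    qed simp
    then show "(\<integral>\<^sup>+ s. v s * indicator {s. 0 < s \<and> 0 \<le> l \<and> ennreal l < F (c * s)} s \<partial>lebesgue) \<le>
        A * (\<integral>\<^sup>+ s. v s * indicator {s. 0 < s \<and> 0 \<le> l \<and> ennreal l < F s} s \<partial>lebesgue)"
      unfolding V by (simp add: U_def)
  qed
  also have "\<dots> = A * (\<integral>\<^sup>+ s \<in> {0<..}. F s * v s \<partial>lebesgue)"
  proof -
    interpret lb: sigma_finite_measure "lebesgue :: real measure"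
      by (rule sigma_finite_measure_lebesgue)
    have "(\<lambda>l. \<integral>\<^sup>+ s. v s * indicator {s. 0 < s \<and> 0 \<le> l \<and> ennreal l < F s} s \<partial>lebesgue)
        \<in> borel_measurable lborel"
      by (rule lb.borel_measurable_nn_integral) measurable
    then show ?thesis by (subst layer) (measurable, rule nn_integral_cmult)
  qed
  finally show ?thesis .
qed

section \<open>A Hardy inequality\<close>

text \<open>Only the points t / 2^j below s count. Their powers decrease with ratio 2^(-p) and start
  at most at min(s, t)^p, so D is the sum of the geometric series; the induction halves t and uses D
  = 1 + D 2^(-p). A sum of tails over all dyadic points can thus be charged to the single kernel
  min(s, t)^p.\<close>

lemma sum_dyadic_powr_le:
  fixes s t p :: real
  assumes p: "0 < p" and "0 < s"
  defines "D \<equiv> 1 / (1 - 2 powr (- p))"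
  shows "0 < t \<Longrightarrow> (\<Sum>j<n. if t / 2 ^ j < s then (t / 2 ^ j) powr p else 0) \<le> D * min s t powr p"
proof (induction n arbitrary: t)
  case 0
  have "2 powr (- p) < 1" using \<open>0 < p\<close> by (simp add: powr_less_one)
  then show ?case by (simp add: D_def)
next
  case (Suc n)
  have lt1: "2 powr (- p) < 1" using \<open>0 < p\<close> by (simp add: powr_less_one)
  then have D: "0 < D" by (simp add: D_def)
  have "D * (1 - 2 powr (- p)) = 1" using lt1 p by (simp add: D_def)
  then have D_eq: "D = 1 + D * 2 powr (- p)" by (simp add: algebra_simps)
  have "(\<Sum>j<Suc n. if t / 2 ^ j < s then (t / 2 ^ j) powr p else 0) =
      (if t < s then t powr p else 0) + (\<Sum>j<n. if t / 2 / 2 ^ j < s then (t / 2 / 2 ^ j) powr p else 0)"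
  proof -
    have "t / 2 ^ Suc j = t / 2 / 2 ^ j" for j by simp
    then show ?thesis by (subst sum.lessThan_Suc_shift) (simp only: power_0 div_by_1)
  qed
  also have "\<dots> \<le> (if t < s then t powr p else 0) + D * min s (t / 2) powr p"
    using Suc.prems by (intro add_left_mono Suc.IH) simp
  also have "\<dots> \<le> D * min s t powr p"
  proof (cases "t < s")
    case True
    have "(t / 2) powr p = t powr p * 2 powr (- p)"
      using Suc.prems by (simp add: powr_divide powr_minus_divide)
    moreover have "t powr p + D * (t powr p * 2 powr (- p)) = t powr p * (1 + D * 2 powr (- p))"
      by (simp add: algebra_simps)
    ultimately show ?thesis using True Suc.prems by (simp add: min_def D_eq[symmetric])
  next
    case False
    then have "min s (t / 2) powr p \<le> min s t powr p"
      using assms Suc.prems by (intro powr_mono2) auto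
    then show ?thesis using False D by simp
  qed
  finally show ?case .
qed

lemma ennreal_mult_mult_cong:
  fixes a b c d :: real and x :: ennreal
  assumes "0 \<le> a" "0 \<le> b" "0 \<le> c" "0 \<le> d" "a * b = c * d"
  shows "ennreal a * (ennreal b * x) = ennreal c * (ennreal d * x)"
  using assms by (simp only: mult.assoc[symmetric] ennreal_mult[symmetric])

text \<open>With \<open>Q(t) = \<integral> min(s,t)\<^sup>p v(s) ds\<close>, which is comparable to \<open>t\<^sup>p tail v t\<close>, summing over \<open>t / 2\<^sup>j\<close>
  for \<open>j < n\<close> gives \<open>n Q(t / 2\<^sup>n) \<le> K Q(t)\<close>; hence \<open>Q\<close> decays geometrically along dyadic points.\<close>

lemma tail_decay:
  fixes p C :: real
  assumes [measurable]: "v \<in> borel_measurable lebesgue" and p: "0 < p" and C: "0 < C"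
    and RB: "\<And>t. 0 < t \<Longrightarrow> (\<integral>\<^sup>+ s \<in> {0<..<t}. ennreal (s powr p) * v s \<partial>lebesgue) \<le>
      ennreal C * ennreal (t powr p) * tail v t"
  obtains A \<rho> :: real where "0 < A" "0 < \<rho>" "\<rho> < 1"
    "\<And>t k. 0 < t \<Longrightarrow> tail v (t / 2 ^ k) \<le> ennreal (A * \<rho> ^ k * (2 powr p) ^ k) * tail v t"
proof -
  define D where "D = 1 / (1 - 2 powr (- p))"
  have "2 powr (- p) < 1" using p by (simp add: powr_less_one)
  then have D: "0 < D" by (simp add: D_def)
  define Q where "Q t = (\<integral>\<^sup>+ s \<in> {0<..}. ennreal (min s t powr p) * v s \<partial>lebesgue)" for t
  have Q_ge: "ennreal (t powr p) * tail v t \<le> Q t" if "0 < t" for t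
  proof -
    have "ennreal (t powr p) * tail v t = (\<integral>\<^sup>+ s. ennreal (t powr p) * (v s * indicator {t<..} s) \<partial>lebesgue)"
      unfolding tail_def by (rule nn_integral_cmult[symmetric]) measurable
    also have "\<dots> \<le> Q t"
      unfolding Q_def using that by (intro nn_integral_mono) (auto split: split_indicator simp: min_def)
    finally show ?thesis .
  qed
  have Q_le: "Q t \<le> ennreal ((1 + C) * t powr p) * tail v t" if "0 < t" for t
  proof -
    have "Q t \<le> (\<integral>\<^sup>+ s. ennreal (s powr p) * v s * indicator {0<..<t} s
        + ennreal (t powr p) * (v s * indicator {t..} s) \<partial>lebesgue)"
      unfolding Q_def by (intro nn_integral_mono) (auto split: split_indicator simp: min_def)
    also have "\<dots> = (\<integral>\<^sup>+ s \<in> {0<..<t}. ennreal (s powr p) * v s \<partial>lebesgue)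
        + ennreal (t powr p) * tail v t"
      by (subst nn_integral_add, measurable, subst nn_integral_cmult, measurable)
        (simp add: nn_integral_atLeast_eq_tail)
    also have "\<dots> \<le> ennreal C * ennreal (t powr p) * tail v t + ennreal (t powr p) * tail v t"
      by (intro add_right_mono RB that)
    also have "\<dots> = ennreal ((1 + C) * t powr p) * tail v t"
      using C by (simp add: ennreal_mult distrib_right add_ac ring_distribs)
    finally show ?thesis .
  qed
  have Q_mono: "Q s \<le> Q t" if "0 < s" "s \<le> t" for s t
    unfolding Q_def using that p
    by (intro nn_integral_mono)
      (auto intro!: mult_right_mono ennreal_leI powr_mono2 split: split_indicator)
  have Q_sum: "(\<Sum>j<n. ennreal ((t / 2 ^ j) powr p) * tail v (t / 2 ^ j)) \<le> ennreal D * Q t"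
    if "0 < t" for t n
  proof -
    have "(\<Sum>j<n. ennreal ((t / 2 ^ j) powr p) * tail v (t / 2 ^ j)) =
      (\<Sum>j<n. \<integral>\<^sup>+ s. ennreal ((t / 2 ^ j) powr p) * (v s * indicator {t / 2 ^ j<..} s) \<partial>lebesgue)"
      unfolding tail_def by (intro sum.cong refl nn_integral_cmult[symmetric]) measurable
    also have "\<dots> = (\<integral>\<^sup>+ s. (\<Sum>j<n. ennreal ((t / 2 ^ j) powr p) * (v s * indicator {t / 2 ^ j<..} s)) \<partial>lebesgue)"
      by (rule nn_integral_sum[symmetric]) measurable
    also have "\<dots> \<le> (\<integral>\<^sup>+ s. ennreal D * (ennreal (min s t powr p) * v s * indicator {0<..} s) \<partial>lebesgue)"
    proof (rule nn_integral_mono)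
      fix s
      show "(\<Sum>j<n. ennreal ((t / 2 ^ j) powr p) * (v s * indicator {t / 2 ^ j<..} s)) \<le>
        ennreal D * (ennreal (min s t powr p) * v s * indicator {0<..} s)"
      proof (cases "0 < s")
        case True
        have "(\<Sum>j<n. ennreal ((t / 2 ^ j) powr p) * (v s * indicator {t / 2 ^ j<..} s)) =
            (\<Sum>j<n. ennreal (if t / 2 ^ j < s then (t / 2 ^ j) powr p else 0) * v s)"
          by (intro sum.cong) auto
        also have "\<dots> = ennreal (\<Sum>j<n. if t / 2 ^ j < s then (t / 2 ^ j) powr p else 0) * v s"
          by (simp add: sum_distrib_right[symmetric])
        also have "\<dots> \<le> ennreal (D * min s t powr p) * v s"
          unfolding D_def using True \<open>0 < t\<close> p
          by (intro mult_right_mono ennreal_leI sum_dyadic_powr_le) auto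
        also have "\<dots> = ennreal D * (ennreal (min s t powr p) * v s * indicator {0<..} s)"
          using D True by (simp add: ennreal_mult mult_ac)
        finally show ?thesis .
      next
        case False
        have "0 < t / 2 ^ j" for j :: nat using \<open>0 < t\<close> by simp
        then have "s \<notin> {t / 2 ^ j<..}" for j :: nat using False
          by (metis greaterThan_iff less_trans)
        then show ?thesis by simp
      qed
    qed
    also have "\<dots> = ennreal D * Q t"
      unfolding Q_def by (rule nn_integral_cmult) measurable
    finally show ?thesis .
  qed
  define K where "K = (1 + C) * D"
  have K: "0 < K" using C D by (simp add: K_def)
  \<comment> \<open>The constant K does not depend on n: the n equal summands are dominated by
    distinct terms of one dyadic sum, whose bound is uniform in n. This is what makes RB
    self-improving.\<close>
  have Q_n: "of_nat n * Q (t / 2 ^ n) \<le> ennreal K * Q t" if "0 < t" for t n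
  proof -
    have "of_nat n * Q (t / 2 ^ n) = (\<Sum>j<n. Q (t / 2 ^ n))" by simp
    also have "\<dots> \<le> (\<Sum>j<n. ennreal (1 + C) * (ennreal ((t / 2 ^ j) powr p) * tail v (t / 2 ^ j)))"
    proof (rule sum_mono)
      fix j assume "j \<in> {..<n}"
      then have "Q (t / 2 ^ n) \<le> Q (t / 2 ^ j)"
        using that by (intro Q_mono) (auto intro!: divide_left_mono power_increasing)
      also have "\<dots> \<le> ennreal ((1 + C) * (t / 2 ^ j) powr p) * tail v (t / 2 ^ j)"
        using that by (intro Q_le) auto
      finally show "Q (t / 2 ^ n) \<le> ennreal (1 + C) * (ennreal ((t / 2 ^ j) powr p) * tail v (t / 2 ^ j))"
        using C by (simp add: ennreal_mult mult_ac del: ennreal_plus)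
    qed
    also have "\<dots> \<le> ennreal (1 + C) * (ennreal D * Q t)"
      unfolding sum_distrib_left[symmetric] by (intro mult_left_mono Q_sum that) simp
    also have "\<dots> = ennreal K * Q t"
      using C D by (simp add: K_def ennreal_mult mult_ac del: ennreal_plus)
    finally show ?thesis .
  qed
  \<comment> \<open>With n \<ge> 2 K, dividing the argument by 2^n at least halves Q.\<close>
  obtain n where n: "2 * K \<le> real n" using real_arch_simple by blast
  with K have "0 < n" by (cases n) auto
  have half: "Q (t / 2 ^ n) \<le> ennreal (1 / 2) * Q t" if "0 < t" for t
  proof -
    have "ennreal (2 * K) * Q (t / 2 ^ n) \<le> of_nat n * Q (t / 2 ^ n)"
      using n by (intro mult_right_mono) (auto simp: ennreal_of_nat_eq_real_of_nat simp del: ennreal_numeral intro!: ennreal_leI)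
    also have "\<dots> \<le> ennreal K * Q t" by (rule Q_n[OF that])
    also have "\<dots> = ennreal (2 * K) * (ennreal (1 / 2) * Q t)"
      using K by (simp add: mult.assoc[symmetric] ennreal_mult[symmetric] del: ennreal_half)
    finally show ?thesis
      using K by (subst (asm) ennreal_mult_le_mult_iff) auto
  qed
  have half_pow: "Q (t / 2 ^ (n * m)) \<le> ennreal ((1 / 2) ^ m) * Q t" if "0 < t" for t m
  proof (induction m)
    case (Suc m)
    have "Q (t / 2 ^ (n * Suc m)) = Q ((t / 2 ^ (n * m)) / 2 ^ n)"
      by (simp add: power_add mult.commute)
    also have "\<dots> \<le> ennreal (1 / 2) * Q (t / 2 ^ (n * m))"
      using that by (intro half) auto
    also have "\<dots> \<le> ennreal (1 / 2) * (ennreal ((1 / 2) ^ m) * Q t)"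
      by (intro mult_left_mono Suc) auto
    also have "\<dots> = ennreal ((1 / 2) ^ Suc m) * Q t"
      by (simp add: mult.assoc[symmetric] ennreal_mult[symmetric] del: ennreal_half)
    finally show ?case .
  qed simp
  \<comment> \<open>The n-th root of 1/2 spreads one halving over n dyadic steps. An incomplete
    block of k mod n steps costs at most a factor 2, whence the 2 in \<open>half_le\<close>.\<close>
  define \<rho> :: real where "\<rho> = 2 powr (- (1 / n))"
  have \<rho>: "0 < \<rho>" "\<rho> < 1" using \<open>0 < n\<close> by (auto simp: \<rho>_def powr_less_one)
  have half_le: "(1 / 2) ^ (k div n) \<le> 2 * \<rho> ^ k" for k
  proof -
    have k: "real k = real n * real (k div n) + real (k mod n)"
      by (metis mult_div_mod_eq of_nat_add of_nat_mult)
    have "real (k mod n) < real n" using \<open>0 < n\<close> by simp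
    then have "real k / n \<le> real (k div n) + 1"
      using \<open>0 < n\<close> by (subst k) (simp add: field_simps)
    then have "2 powr (- real (k div n)) \<le> 2 powr (1 - real k / n)"
      by (intro powr_mono) auto
    also have "\<dots> = 2 * \<rho> ^ k"
    proof -
      have "\<rho> ^ k = 2 powr (- (real k / n))"
        by (simp add: \<rho>_def powr_realpow[symmetric] powr_powr)
      moreover have "2 powr (1 - x) = 2 * 2 powr (- x)" for x :: real
        by (simp add: powr_diff powr_minus divide_inverse)
      ultimately show ?thesis by simp
    qed
    finally show ?thesis
      by (simp add: powr_minus_divide powr_realpow power_one_over)
  qed
  \<comment> \<open>The factor 2 comes from \<open>half_le\<close> and 1 + C from
    \<open>Q_le\<close>. Monotonicity of Q alone would already bound the tail with growth (2^p)^k;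
    the factor \<rho>^k is the gain.\<close>
  show ?thesis
  proof (rule that[of "2 * (1 + C)" \<rho>])
    fix t :: real and k :: nat assume t: "0 < t"
    have "ennreal ((t / 2 ^ k) powr p) * tail v (t / 2 ^ k) \<le> Q (t / 2 ^ k)"
      using t by (intro Q_ge) auto
    also have "\<dots> \<le> Q (t / 2 ^ (n * (k div n)))"
      using t by (intro Q_mono) (auto intro!: divide_left_mono power_increasing)
    also have "\<dots> \<le> ennreal ((1 / 2) ^ (k div n)) * Q t" by (rule half_pow[OF t])
    also have "\<dots> \<le> ennreal (2 * \<rho> ^ k) * (ennreal ((1 + C) * t powr p) * tail v t)"
      using half_le by (intro mult_mono ennreal_leI Q_le t) auto
    also have "\<dots> = ennreal ((t / 2 ^ k) powr p) * (ennreal (2 * (1 + C) * \<rho> ^ k * (2 powr p) ^ k) * tail v t)"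
    proof -
      have "(2 ^ k) powr p = (2 powr p) ^ k"
        by (simp add: powr_realpow[symmetric] powr_powr mult.commute)
      then have "(2 * \<rho> ^ k) * ((1 + C) * t powr p) = (t / 2 ^ k) powr p * (2 * (1 + C) * \<rho> ^ k * (2 powr p) ^ k)"
        using t by (simp add: powr_divide)
      then show ?thesis
        using C \<rho> by (intro ennreal_mult_mult_cong) auto
    qed
    finally show "tail v (t / 2 ^ k) \<le> ennreal (2 * (1 + C) * \<rho> ^ k * (2 powr p) ^ k) * tail v t"
      using t by (subst (asm) ennreal_mult_le_mult_iff) auto
  qed (use C \<rho> in auto)
qed

text \<open>A weighted substitute for Minkowski's inequality that is valid for all \<open>p > 0\<close>.\<close>

lemma enn_powr_suminf_le:
  fixes a :: "nat \<Rightarrow> ennreal" and p \<sigma> :: real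
  assumes p: "0 < p" and \<sigma>: "0 < \<sigma>" "\<sigma> < 1"
  shows "enn_powr (\<Sum>k. a k) p \<le>
    ennreal ((1 / (1 - \<sigma>)) powr p) * (\<Sum>k. ennreal ((\<sigma> powr (- p)) ^ k) * enn_powr (a k) p)"
proof -
  define S where "S = (\<Sum>k. ennreal ((\<sigma> powr (- p)) ^ k) * enn_powr (a k) p)"
  \<comment> \<open>A single summand of S already dominates the corresponding a(k) up to its weight.
    Only a geometric series in \<sigma> remains to be summed, so no convexity in p enters.\<close>
  have a: "a k \<le> ennreal (\<sigma> ^ k) * enn_powr S (1 / p)" for k
  proof -
    let ?f = "\<lambda>k. ennreal ((\<sigma> powr (- p)) ^ k) * enn_powr (a k) p"
    have pow: "ennreal ((\<sigma> powr (- p)) ^ k) = enn_powr (ennreal ((1 / \<sigma>) ^ k)) p"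
    proof -
      have "((1 / \<sigma>) ^ k) powr p = (\<sigma> powr (- p)) ^ k"
        using \<sigma> by (simp add: powr_realpow[symmetric] powr_powr powr_divide powr_minus_divide[symmetric] mult.commute)
      then show ?thesis using \<sigma> by (simp add: enn_powr_ennreal)
    qed
    have "?f k = (\<Sum>k\<in>{k}. ?f k)" by simp
    also have "\<dots> \<le> S" unfolding S_def by (rule sum_le_suminf) auto
    finally have "enn_powr (ennreal ((1 / \<sigma>) ^ k) * a k) p \<le> S"
      using p by (simp only: pow enn_powr_mult)
    then have "enn_powr (enn_powr (ennreal ((1 / \<sigma>) ^ k) * a k) p) (1 / p) \<le> enn_powr S (1 / p)"
      using p by (intro enn_powr_mono) auto
    then have "ennreal ((1 / \<sigma>) ^ k) * a k \<le> enn_powr S (1 / p)"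
      using p by (simp only: enn_powr_powr_inverse)
    then have "ennreal (\<sigma> ^ k) * (ennreal ((1 / \<sigma>) ^ k) * a k) \<le> ennreal (\<sigma> ^ k) * enn_powr S (1 / p)"
      by (intro mult_left_mono) auto
    moreover have "\<sigma> ^ k * (1 / \<sigma>) ^ k = 1" using \<sigma> by (simp add: power_one_over)
    ultimately show ?thesis
      using \<sigma> by (simp add: mult.assoc[symmetric] ennreal_mult[symmetric])
  qed
  have "(\<Sum>k. a k) \<le> (\<Sum>k. ennreal (\<sigma> ^ k) * enn_powr S (1 / p))"
    by (intro suminf_le a) auto
  also have "\<dots> = (\<Sum>k. ennreal (1 * \<sigma> ^ k)) * enn_powr S (1 / p)" by simp
  also have "\<dots> = ennreal (1 / (1 - \<sigma>)) * enn_powr S (1 / p)"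
    using \<sigma> by (subst suminf_ennreal_geometric) auto
  finally have "enn_powr (\<Sum>k. a k) p \<le> enn_powr (ennreal (1 / (1 - \<sigma>)) * enn_powr S (1 / p)) p"
    using p by (intro enn_powr_mono)
  also have "\<dots> = ennreal ((1 / (1 - \<sigma>)) powr p) * S"
    using p \<sigma> by (simp add: enn_powr_mult enn_powr_inverse_powr enn_powr_ennreal)
  finally show ?thesis unfolding S_def .
qed

text \<open>Using the hypothesis at 2^n s and dividing by 2^n telescopes H along dyadic points, and
  the remainder s H(2^n s) tends to 0. With H = f* and G the oscillation mass this recovers f* from
  its oscillation; here the decay of f* at infinity enters the Hardy inequality.\<close>

lemma dyadic_telescope_le:
  fixes G H :: "real \<Rightarrow> ennreal"
  assumes H: "\<And>s. 0 < s \<Longrightarrow> ennreal s * H s \<le> ennreal s * H (2 * s) + G (2 * s)"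
    and lim: "(H \<longlongrightarrow> 0) at_top" and s: "0 < s"
  shows "ennreal s * H s \<le> (\<Sum>k. ennreal ((1 / 2) ^ k) * G (2 ^ Suc k * s))"
proof -
  let ?a = "\<lambda>k. ennreal ((1 / 2) ^ k) * G (2 ^ Suc k * s)"
  have "ennreal s * H s \<le> ennreal s * H (2 ^ n * s) + (\<Sum>k<n. ?a k)" for n
  proof (induction n)
    case (Suc n)
    have "ennreal s * H (2 ^ n * s) = ennreal ((1 / 2) ^ n) * (ennreal (2 ^ n * s) * H (2 ^ n * s))"
      using s by (simp add: mult.assoc[symmetric] ennreal_mult[symmetric] power_one_over)
    also have "\<dots> \<le> ennreal ((1 / 2) ^ n) * (ennreal (2 ^ n * s) * H (2 * (2 ^ n * s)) + G (2 * (2 ^ n * s)))"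
      using s by (intro mult_left_mono H) auto
    also have "\<dots> = ennreal s * H (2 ^ Suc n * s) + ?a n"
      using s by (simp add: distrib_left mult.assoc[symmetric] ennreal_mult[symmetric] power_one_over)
    finally show ?case
      using Suc by (auto simp: add_ac intro: order_trans add_right_mono add_left_mono)
  qed simp
  moreover have "(\<Sum>k<n. ?a k) \<le> (\<Sum>k. ?a k)" for n by (rule sum_le_suminf) auto
  ultimately have le: "ennreal s * H s \<le> ennreal s * H (2 ^ n * s) + (\<Sum>k. ?a k)" for n
    by (meson add_left_mono order_trans)
  have "filterlim (\<lambda>n. 2 ^ n * s) at_top sequentially"
    using s by (intro filterlim_at_top_mult_tendsto_pos[where c = s]) (auto intro!: filterlim_at_infinity_imp_filterlim_at_top filterlim_realpow_sequentially_gt1)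
  then have "(\<lambda>n. H (2 ^ n * s)) \<longlonglongrightarrow> 0" by (rule filterlim_compose[OF lim])
  then have "(\<lambda>n. ennreal s * H (2 ^ n * s)) \<longlonglongrightarrow> ennreal s * 0"
    by (intro ennreal_tendsto_cmult) auto
  then have "(\<lambda>n. ennreal s * H (2 ^ n * s) + (\<Sum>k. ?a k)) \<longlonglongrightarrow> ennreal s * 0 + (\<Sum>k. ?a k)"
    by (intro tendsto_add tendsto_const)
  then show ?thesis
    by (intro LIMSEQ_le_const[where X = "\<lambda>n. ennreal s * H (2 ^ n * s) + (\<Sum>k. ?a k)"])
      (use le in auto)
qed

text \<open>The k-th term of the telescoping series carries 2^(-k p) once the power is taken, while
  dilating G by 2^(k+1) costs a multiple of (\<rho> 2^p)^(k+1). The powers of 2 cancel up to one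
  factor and \<rho>^k is left. B is chosen before G and H, hence uniform in the functions to which
  this is applied.\<close>

lemma hardy_dyadic:
  fixes p C :: real
  assumes [measurable]: "v \<in> borel_measurable lebesgue" and p: "0 < p" and C: "0 < C"
    and RB: "\<And>t. 0 < t \<Longrightarrow> (\<integral>\<^sup>+ s \<in> {0<..<t}. ennreal (s powr p) * v s \<partial>lebesgue) \<le>
      ennreal C * ennreal (t powr p) * tail v t"
  obtains B :: real where "0 < B"
    "\<And>G H. mono G \<Longrightarrow> (\<And>s. 0 < s \<Longrightarrow> ennreal s * H s \<le> ennreal s * H (2 * s) + G (2 * s)) \<Longrightarrow>
      (H \<longlongrightarrow> 0) at_top \<Longrightarrow> (\<integral>\<^sup>+ s \<in> {0<..}. enn_powr (ennreal s * H s) p * v s \<partial>lebesgue) \<le>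
        ennreal B * (\<integral>\<^sup>+ s \<in> {0<..}. enn_powr (G s) p * v s \<partial>lebesgue)"
proof -
  obtain A \<rho> :: real where A: "0 < A" and \<rho>: "0 < \<rho>" "\<rho> < 1"
    and decay: "\<And>t k. 0 < t \<Longrightarrow> tail v (t / 2 ^ k) \<le> ennreal (A * \<rho> ^ k * (2 powr p) ^ k) * tail v t"
    using tail_decay[OF assms(1) p C RB] by blast
  \<comment> \<open>The gain \<rho>^k is shared: the weights of \<open>enn_powr_suminf_le\<close>
    have ratio \<sigma>^(-p) = 1 / \<tau>, and \<rho> / \<tau> = \<tau> < 1 still leaves a
    convergent geometric series.\<close>
  define \<tau> where "\<tau> = sqrt \<rho>"
  have \<tau>: "0 < \<tau>" "\<tau> < 1" "\<rho> = \<tau> * \<tau>" using \<rho> by (auto simp: \<tau>_def)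
  define \<sigma> where "\<sigma> = \<tau> powr (1 / p)"
  have \<sigma>: "0 < \<sigma>" "\<sigma> < 1" "\<sigma> powr (- p) = 1 / \<tau>"
    using \<tau> p by (auto simp: \<sigma>_def powr_powr powr_minus_divide powr01_less_one)
  define E where "E = (1 / (1 - \<sigma>)) powr p"
  define B where "B = E * (A * \<rho> * 2 powr p / (1 - \<tau>))"
  have E: "0 < E" using \<sigma> by (simp add: E_def)
  show ?thesis
  proof (rule that[of B])
    show "0 < B" using E A \<rho> \<tau> by (simp add: B_def)
    fix G H :: "real \<Rightarrow> ennreal"
    assume G: "mono G" and H: "\<And>s. 0 < s \<Longrightarrow> ennreal s * H s \<le> ennreal s * H (2 * s) + G (2 * s)"
      and lim: "(H \<longlongrightarrow> 0) at_top"
    have [measurable]: "G \<in> borel_measurable borel" by (rule borel_measurable_ennreal_mono[OF G])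
    let ?I = "\<integral>\<^sup>+ s \<in> {0<..}. enn_powr (G s) p * v s \<partial>lebesgue"
    let ?b = "\<lambda>k. ennreal ((1 / \<tau>) ^ k * ((1 / 2) ^ k) powr p)"
    have "(\<integral>\<^sup>+ s \<in> {0<..}. enn_powr (ennreal s * H s) p * v s \<partial>lebesgue) \<le>
      (\<integral>\<^sup>+ s. ennreal E * (\<Sum>k. ?b k * (enn_powr (G (2 ^ Suc k * s)) p * v s * indicator {0<..} s)) \<partial>lebesgue)"
    proof (rule nn_integral_mono)
      fix s
      show "enn_powr (ennreal s * H s) p * v s * indicator {0<..} s \<le>
        ennreal E * (\<Sum>k. ?b k * (enn_powr (G (2 ^ Suc k * s)) p * v s * indicator {0<..} s))"
      proof (cases "0 < s")
        case True
        have "enn_powr (ennreal s * H s) p \<le> enn_powr (\<Sum>k. ennreal ((1 / 2) ^ k) * G (2 ^ Suc k * s)) p"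
          using p by (intro enn_powr_mono dyadic_telescope_le H lim True)
        also have "\<dots> \<le> ennreal E * (\<Sum>k. ennreal ((1 / \<tau>) ^ k) * enn_powr (ennreal ((1 / 2) ^ k) * G (2 ^ Suc k * s)) p)"
          using enn_powr_suminf_le[OF p \<sigma>(1,2)] \<sigma>(3) by (simp only: E_def)
        also have "\<dots> = ennreal E * (\<Sum>k. ?b k * enn_powr (G (2 ^ Suc k * s)) p)"
          using p \<tau> by (simp add: enn_powr_mult enn_powr_ennreal ennreal_mult mult.assoc)
        finally have "enn_powr (ennreal s * H s) p * v s \<le>
            ennreal E * (\<Sum>k. ?b k * enn_powr (G (2 ^ Suc k * s)) p) * v s"
          by (intro mult_right_mono) auto
        then show ?thesis using True by (simp add: mult.assoc flip: ennreal_suminf_multc)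
      qed simp
    qed
    also have "\<dots> = ennreal E * (\<integral>\<^sup>+ s. (\<Sum>k. ?b k * (enn_powr (G (2 ^ Suc k * s)) p * v s * indicator {0<..} s)) \<partial>lebesgue)"
      by (rule nn_integral_cmult) measurable
    also have "\<dots> = ennreal E * (\<Sum>k. \<integral>\<^sup>+ s. ?b k * (enn_powr (G (2 ^ Suc k * s)) p * v s * indicator {0<..} s) \<partial>lebesgue)"
      by (intro arg_cong2[where f = times] refl nn_integral_suminf) measurable
    also have "\<dots> = ennreal E * (\<Sum>k. ?b k * (\<integral>\<^sup>+ s \<in> {0<..}. enn_powr (G (2 ^ Suc k * s)) p * v s \<partial>lebesgue))"
      by (intro arg_cong2[where f = times] refl suminf_cong nn_integral_cmult) measurable
    also have "\<dots> \<le> ennreal E * (\<Sum>k. ennreal (A * \<rho> * 2 powr p * \<tau> ^ k) * ?I)"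
    proof (intro mult_left_mono suminf_le)
      fix k
      have "(\<integral>\<^sup>+ s \<in> {0<..}. enn_powr (G (2 ^ Suc k * s)) p * v s \<partial>lebesgue) \<le>
          ennreal (A * \<rho> ^ Suc k * (2 powr p) ^ Suc k) * ?I"
      proof (rule nn_integral_mono_dilation_le[where F = "\<lambda>s. enn_powr (G s) p"])
        show "mono (\<lambda>s. enn_powr (G s) p)"
          using G p by (auto simp: mono_def intro: enn_powr_mono)
        show "tail v (a / 2 ^ Suc k) \<le> ennreal (A * \<rho> ^ Suc k * (2 powr p) ^ Suc k) * tail v a"
          if "0 < a" for a by (rule decay[OF that])
      qed auto
      then have "?b k * (\<integral>\<^sup>+ s \<in> {0<..}. enn_powr (G (2 ^ Suc k * s)) p * v s \<partial>lebesgue) \<le>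
          ?b k * (ennreal (A * \<rho> ^ Suc k * (2 powr p) ^ Suc k) * ?I)"
        by (rule mult_left_mono) simp
      also have "\<dots> = ennreal (A * \<rho> * 2 powr p * \<tau> ^ k) * ?I"
      proof -
        have "((1 / 2) ^ k) powr p * (2 powr p) ^ k = 1"
          by (simp add: powr_realpow[symmetric] powr_powr powr_divide mult.commute)
        moreover have "(1 / \<tau>) ^ k * \<rho> ^ k = \<tau> ^ k"
          using \<tau> by (simp flip: power_mult_distrib)
        moreover have "(1 / \<tau>) ^ k * ((1 / 2) ^ k) powr p * (A * \<rho> ^ Suc k * (2 powr p) ^ Suc k) =
          A * \<rho> * 2 powr p * ((1 / \<tau>) ^ k * \<rho> ^ k) * (((1 / 2) ^ k) powr p * (2 powr p) ^ k)"
          by (simp add: mult_ac)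
        ultimately have "(1 / \<tau>) ^ k * ((1 / 2) ^ k) powr p * (A * \<rho> ^ Suc k * (2 powr p) ^ Suc k) =
          A * \<rho> * 2 powr p * \<tau> ^ k" by simp
        moreover have "?b k * ennreal (A * \<rho> ^ Suc k * (2 powr p) ^ Suc k) =
          ennreal ((1 / \<tau>) ^ k * ((1 / 2) ^ k) powr p * (A * \<rho> ^ Suc k * (2 powr p) ^ Suc k))"
          using \<tau> A \<rho> by (intro ennreal_mult[symmetric]) auto
        ultimately show ?thesis by (simp only: mult.assoc[symmetric])
      qed
      finally show "?b k * (\<integral>\<^sup>+ s \<in> {0<..}. enn_powr (G (2 ^ Suc k * s)) p * v s \<partial>lebesgue) \<le>
          ennreal (A * \<rho> * 2 powr p * \<tau> ^ k) * ?I" .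
    qed auto
    also have "\<dots> = ennreal E * (ennreal (A * \<rho> * 2 powr p / (1 - \<tau>)) * ?I)"
      using A \<rho> \<tau> by (simp only: ennreal_suminf_multc) (subst suminf_ennreal_geometric, auto)
    also have "\<dots> = ennreal B * ?I"
      using E A \<rho> \<tau> by (simp add: B_def ennreal_mult[symmetric] mult.assoc[symmetric])
    finally show "(\<integral>\<^sup>+ s \<in> {0<..}. enn_powr (ennreal s * H s) p * v s \<partial>lebesgue) \<le> ennreal B * ?I" .
  qed
qed

section \<open>Rearrangements\<close>

lemma rearrangement_antimono: "antimono (rearrangement M f)"
proof (intro antimonoI)
  fix s t :: real assume "s \<le> t"
  then have "ennreal s \<le> ennreal t" by (rule ennreal_leI)
  then show "rearrangement M f t \<le> rearrangement M f s"
    unfolding rearrangement_def by (intro Inf_superset_mono) (blast intro: order_trans)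
qed

lemma rearrangement_mono: "s \<le> t \<Longrightarrow> rearrangement M f t \<le> rearrangement M f s"
  using rearrangement_antimono[of M f] by (auto simp: antimono_def)

lemma borel_measurable_rearrangement [measurable]: "rearrangement M f \<in> borel_measurable borel"
  by (intro borel_measurable_ennreal_antimono rearrangement_antimono)

lemma rearrangement_le:
  "0 \<le> l \<Longrightarrow> emeasure M {x \<in> space M. l < \<bar>f x\<bar>} \<le> ennreal t \<Longrightarrow> rearrangement M f t \<le> ennreal l"
  unfolding rearrangement_def by (rule Inf_lower) auto

lemma rearrangement_greatest:
  "(\<And>l. 0 \<le> l \<Longrightarrow> emeasure M {x \<in> space M. l < \<bar>f x\<bar>} \<le> ennreal t \<Longrightarrow> y \<le> ennreal l) \<Longrightarrow>
    y \<le> rearrangement M f t"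
  unfolding rearrangement_def by (rule Inf_greatest) auto

text \<open>As f* tends to 0, some superlevel set has finite measure. As f is real-valued, the
  superlevel sets shrink to the empty set, and continuity from above makes one of them smaller than
  t.\<close>

lemma rearrangement_less_top:
  assumes [measurable]: "f \<in> borel_measurable M"
    and lim: "(rearrangement M f \<longlongrightarrow> 0) at_top" and t: "0 < t"
  shows "rearrangement M f t < \<infinity>"
proof -
  have "eventually (\<lambda>T. rearrangement M f T < 1) at_top"
    using lim by (rule order_tendstoD) simp
  then obtain T where "rearrangement M f T < 1"
    using eventually_happens by fastforce
  then obtain l where l: "0 \<le> l" "emeasure M {x \<in> space M. l < \<bar>f x\<bar>} \<le> ennreal T"
    unfolding rearrangement_def Inf_less_iff by auto
  define A where "A n = {x \<in> space M. l + real n < \<bar>f x\<bar>}" for n :: nat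
  have "(\<lambda>n. emeasure M (A n)) \<longlonglongrightarrow> emeasure M (\<Inter>n. A n)"
  proof (rule Lim_emeasure_decseq)
    show "range A \<subseteq> sets M" unfolding A_def by auto
    show "decseq A" unfolding A_def by (auto simp: decseq_def)
    show "emeasure M (A n) \<noteq> \<infinity>" for n
    proof -
      have "emeasure M (A n) \<le> emeasure M {x \<in> space M. l < \<bar>f x\<bar>}"
        unfolding A_def by (intro emeasure_mono) auto
      with l show ?thesis by (auto simp: top_unique)
    qed
  qed
  moreover have "(\<Inter>n. A n) = {}"
  proof -
    have "x \<notin> (\<Inter>n. A n)" for x
    proof -
      obtain n :: nat where "\<bar>f x\<bar> \<le> real n" using real_arch_simple by blast
      then have "x \<notin> A n" using l by (auto simp: A_def)
      then show ?thesis by auto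
    qed
    then show ?thesis by auto
  qed
  ultimately have "(\<lambda>n. emeasure M (A n)) \<longlonglongrightarrow> 0" by simp
  then have "eventually (\<lambda>n. emeasure M (A n) < ennreal t) sequentially"
    by (rule order_tendstoD) (use t in simp)
  then obtain n where "emeasure M (A n) < ennreal t"
    using eventually_happens by fastforce
  then have "rearrangement M f t \<le> ennreal (l + real n)"
    using l unfolding A_def by (intro rearrangement_le) auto
  then show ?thesis using le_less_trans by fastforce
qed

text \<open>Where |f| exceeds l0 + l1, either |f0| exceeds l0 or |f1| exceeds l1. The two infima are
  taken one after the other by subtracting the other term; \<open>fin\<close> keeps the second
  subtraction away from \<infinity> - \<infinity>.\<close>

lemma rearrangement_add_le:
  assumes [measurable]: "f0 \<in> borel_measurable M" "f1 \<in> borel_measurable M"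
    and f: "decomposes M f f0 f1" and st: "0 \<le> s" "0 \<le> t" and fin: "rearrangement M f0 s < \<infinity>"
  shows "rearrangement M f (s + t) \<le> rearrangement M f0 s + rearrangement M f1 t"
proof -
  have le: "rearrangement M f (s + t) \<le> ennreal l0 + ennreal l1"
    if l: "0 \<le> l0" "emeasure M {x \<in> space M. l0 < \<bar>f0 x\<bar>} \<le> ennreal s"
      "0 \<le> l1" "emeasure M {x \<in> space M. l1 < \<bar>f1 x\<bar>} \<le> ennreal t" for l0 l1
  proof -
    have "emeasure M {x \<in> space M. l0 + l1 < \<bar>f x\<bar>} \<le>
        emeasure M ({x \<in> space M. l0 < \<bar>f0 x\<bar>} \<union> {x \<in> space M. l1 < \<bar>f1 x\<bar>})"
      using f by (intro emeasure_mono) (auto simp: decomposes_def)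
    also have "\<dots> \<le> emeasure M {x \<in> space M. l0 < \<bar>f0 x\<bar>} + emeasure M {x \<in> space M. l1 < \<bar>f1 x\<bar>}"
      by (intro emeasure_subadditive) auto
    also have "\<dots> \<le> ennreal (s + t)"
      using l st by (simp add: add_mono)
    finally have "rearrangement M f (s + t) \<le> ennreal (l0 + l1)"
      using l by (intro rearrangement_le) auto
    then show ?thesis using l by simp
  qed
  have "rearrangement M f (s + t) \<le> ennreal l1 + rearrangement M f0 s"
    if "0 \<le> l1" "emeasure M {x \<in> space M. l1 < \<bar>f1 x\<bar>} \<le> ennreal t" for l1
  proof -
    have "rearrangement M f (s + t) - ennreal l1 \<le> rearrangement M f0 s"
      by (rule rearrangement_greatest) (use that le in \<open>auto simp: ennreal_minus_le_iff add.commute\<close>)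
    then show ?thesis by (simp add: ennreal_minus_le_iff)
  qed
  then have "rearrangement M f (s + t) - rearrangement M f0 s \<le> rearrangement M f1 t"
    using fin by (intro rearrangement_greatest) (auto simp: ennreal_minus_le_iff add.commute)
  then show ?thesis by (simp add: ennreal_minus_le_iff)
qed

lemma rearrangement_uminus: "rearrangement M (\<lambda>x. - f x) = rearrangement M f"
  by (simp add: rearrangement_def fun_eq_iff)

text \<open>The superlevel set of f0 at height l is that of f at height l + c. Only |f0| matters, so
  the truncation may keep the sign of f.\<close>

lemma rearrangement_truncate_above:
  assumes [measurable]: "f \<in> borel_measurable M" and c: "0 \<le> c"
    and f0: "\<And>x. x \<in> space M \<Longrightarrow> \<bar>f0 x\<bar> = max 0 (\<bar>f x\<bar> - c)"
  shows "rearrangement M f0 s = rearrangement M f s - ennreal c"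
proof (rule antisym)
  have eq: "{x \<in> space M. l < \<bar>f0 x\<bar>} = {x \<in> space M. l + c < \<bar>f x\<bar>}" if "0 \<le> l" for l
    using that f0 by auto
  show "rearrangement M f s - ennreal c \<le> rearrangement M f0 s"
  proof (rule rearrangement_greatest)
    fix l :: real assume "0 \<le> l" "emeasure M {x \<in> space M. l < \<bar>f0 x\<bar>} \<le> ennreal s"
    then have "rearrangement M f s \<le> ennreal (l + c)"
      using c by (intro rearrangement_le) (auto simp: eq)
    then show "rearrangement M f s - ennreal c \<le> ennreal l"
      using c \<open>0 \<le> l\<close> by (simp add: ennreal_minus_le_iff add.commute)
  qed
  have le: "rearrangement M f0 s \<le> ennreal l - ennreal c"
    if l: "0 \<le> l" "emeasure M {x \<in> space M. l < \<bar>f x\<bar>} \<le> ennreal s" for l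
  proof -
    have "emeasure M {x \<in> space M. max 0 (l - c) < \<bar>f0 x\<bar>} \<le> emeasure M {x \<in> space M. l < \<bar>f x\<bar>}"
      by (subst eq) (auto intro!: emeasure_mono)
    then have "rearrangement M f0 s \<le> ennreal (max 0 (l - c))"
      using l by (intro rearrangement_le) auto
    also have "\<dots> = ennreal l - ennreal c"
      using c by (simp add: ennreal_minus max_def ennreal_neg)
    finally show ?thesis .
  qed
  show "rearrangement M f0 s \<le> rearrangement M f s - ennreal c"
  \<comment> \<open>Subtraction is truncated: x \<le> y - c may be replaced by x + c \<le> y only
    when x is not 0.\<close>
  proof (cases "rearrangement M f0 s = 0")
    case False
    have "rearrangement M f0 s + ennreal c \<le> rearrangement M f s"
      by (rule rearrangement_greatest) (use le False in \<open>auto simp: ennreal_le_minus_iff\<close>)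
    then show ?thesis by (simp add: ennreal_le_minus_iff)
  qed simp
qed

lemma rearrangement_truncate_below:
  assumes [measurable]: "f \<in> borel_measurable M" and c: "0 \<le> c"
    and f1: "\<And>x. x \<in> space M \<Longrightarrow> \<bar>f1 x\<bar> = min c \<bar>f x\<bar>"
  shows "rearrangement M f1 s = min (ennreal c) (rearrangement M f s)"
proof (rule antisym)
  show "rearrangement M f1 s \<le> min (ennreal c) (rearrangement M f s)"
  proof (rule min.boundedI)
    have "{x \<in> space M. c < \<bar>f1 x\<bar>} = {}" using f1 by auto
    then show "rearrangement M f1 s \<le> ennreal c"
      using c by (intro rearrangement_le) (auto simp del: Collect_empty_eq)
    show "rearrangement M f1 s \<le> rearrangement M f s"
    proof (rule rearrangement_greatest)
      fix l :: real assume l: "0 \<le> l" "emeasure M {x \<in> space M. l < \<bar>f x\<bar>} \<le> ennreal s"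
      have "emeasure M {x \<in> space M. l < \<bar>f1 x\<bar>} \<le> emeasure M {x \<in> space M. l < \<bar>f x\<bar>}"
        using f1 by (intro emeasure_mono) auto
      with l show "rearrangement M f1 s \<le> ennreal l" by (intro rearrangement_le) auto
    qed
  qed
  show "min (ennreal c) (rearrangement M f s) \<le> rearrangement M f1 s"
  proof (rule rearrangement_greatest)
    fix l :: real assume l: "0 \<le> l" "emeasure M {x \<in> space M. l < \<bar>f1 x\<bar>} \<le> ennreal s"
    show "min (ennreal c) (rearrangement M f s) \<le> ennreal l"
    proof (cases "l < c")
      case True
      then have "{x \<in> space M. l < \<bar>f1 x\<bar>} = {x \<in> space M. l < \<bar>f x\<bar>}" using f1 by auto
      with l have "rearrangement M f s \<le> ennreal l" by (intro rearrangement_le) auto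
      then show ?thesis by (rule min.coboundedI2)
    next
      case False
      then show ?thesis using c by (intro min.coboundedI1 ennreal_leI) simp
    qed
  qed
qed

section \<open>Integrated rearrangement and integrated oscillation\<close>

definition rearrangement_mass :: "'a measure \<Rightarrow> ('a \<Rightarrow> real) \<Rightarrow> real \<Rightarrow> ennreal" where
  "rearrangement_mass M f t = (\<integral>\<^sup>+ s \<in> {0<..<t}. rearrangement M f s \<partial>lebesgue)"

text \<open>This is G of the overview. Subtracting under the integral avoids a difference of two
  possibly infinite integrals and makes monotonicity visible: as t grows, the domain grows and the
  subtracted value falls.\<close>

definition osc_mass :: "'a measure \<Rightarrow> ('a \<Rightarrow> real) \<Rightarrow> real \<Rightarrow> ennreal" where
  "osc_mass M f t = (\<integral>\<^sup>+ s \<in> {0<..<t}. (rearrangement M f s - rearrangement M f t) \<partial>lebesgue)"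

lemma nn_integral_const_Ioo:
  "0 \<le> t \<Longrightarrow> (\<integral>\<^sup>+ s \<in> {0<..<t}. c \<partial>lebesgue) = ennreal t * c" for t :: real
  by (simp add: nn_integral_cmult_indicator mult.commute)

text \<open>Finiteness of f*(t) allows the constant to be subtracted under the integral; if the mass
  over (0, t) is infinite, both sides are infinite.\<close>

lemma osc_eq:
  assumes t: "0 < t" and fin: "rearrangement M f t < \<infinity>"
  shows "osc M f t = osc_mass M f t / ennreal t"
proof -
  define c where "c = enn2real (rearrangement M f t)"
  have c: "rearrangement M f t = ennreal c" "0 \<le> c" using fin by (auto simp: c_def)
  have "osc_mass M f t = (\<integral>\<^sup>+ s. rearrangement M f s * indicator {0<..<t} s
      - ennreal c * indicator {0<..<t} s \<partial>lebesgue)"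
    unfolding osc_mass_def c by (intro nn_integral_cong) (auto split: split_indicator)
  also have "\<dots> = rearrangement_mass M f t - ennreal t * ennreal c"
    unfolding rearrangement_mass_def nn_integral_const_Ioo[OF less_imp_le[OF t], symmetric]
  proof (rule nn_integral_diff)
    show "AE s in lebesgue. ennreal c * indicator {0<..<t} s \<le> rearrangement M f s * indicator {0<..<t} s"
      unfolding c(1)[symmetric] by (auto intro!: rearrangement_mono split: split_indicator)
    show "(\<integral>\<^sup>+ s \<in> {0<..<t}. ennreal c \<partial>lebesgue) \<noteq> \<infinity>"
      using t by (subst nn_integral_const_Ioo) (auto simp: ennreal_mult_eq_top_iff)
  qed measurable
  finally have "osc_mass M f t = rearrangement_mass M f t - ennreal (t * c)"
    using t c by (simp add: ennreal_mult)
  then show ?thesis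
    unfolding osc_def max_rearrangement_def rearrangement_mass_def[symmetric] c(1)
    using t c by (cases "rearrangement_mass M f t")
      (auto simp: ennreal_minus_if divide_ennreal ennreal_top_divide field_simps)
qed

lemma osc_mass_mono: "mono (osc_mass M f)"
  unfolding osc_mass_def
  by (intro monoI nn_integral_mono)
    (auto split: split_indicator intro: ennreal_minus_mono rearrangement_mono)

lemma borel_measurable_osc_mass [measurable]: "osc_mass M f \<in> borel_measurable borel"
  by (intro borel_measurable_ennreal_mono osc_mass_mono)

text \<open>On (0, s) the integrand of the oscillation mass at 2 s is at least f*(s) - f*(2 s). This
  is the recursion that \<open>dyadic_telescope_le\<close> and \<open>hardy_dyadic\<close> ask
  for.\<close>

lemma rearrangement_doubling_le:
  assumes s: "0 < s"
  shows "ennreal s * rearrangement M f s \<le> ennreal s * rearrangement M f (2 * s) + osc_mass M f (2 * s)"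
proof -
  let ?d = "rearrangement M f s - rearrangement M f (2 * s)"
  have "ennreal s * ?d = (\<integral>\<^sup>+ r \<in> {0<..<s}. ?d \<partial>lebesgue)"
    using s by (simp add: nn_integral_const_Ioo)
  also have "\<dots> \<le> osc_mass M f (2 * s)"
    unfolding osc_mass_def
    by (intro nn_integral_mono) (auto split: split_indicator intro!: ennreal_minus_mono rearrangement_mono)
  finally have le: "ennreal s * ?d \<le> osc_mass M f (2 * s)" .
  have "rearrangement M f s = rearrangement M f (2 * s) + ?d"
    using s by (intro ennreal_ineq_diff_add rearrangement_mono) auto
  then have "ennreal s * rearrangement M f s = ennreal s * rearrangement M f (2 * s) + ennreal s * ?d"
    by (metis distrib_left)
  with le show ?thesis by (simp add: add_left_mono)
qed

lemma rearrangement_mass_le: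
  assumes "0 < t"
  shows "rearrangement_mass M f t \<le> osc_mass M f t + ennreal t * rearrangement M f t"
proof -
  have "rearrangement_mass M f t \<le> (\<integral>\<^sup>+ s. (rearrangement M f s - rearrangement M f t) * indicator {0<..<t} s
      + rearrangement M f t * indicator {0<..<t} s \<partial>lebesgue)"
    unfolding rearrangement_mass_def
    by (intro nn_integral_mono) (auto split: split_indicator simp: diff_add_self_ennreal)
  also have "\<dots> = osc_mass M f t + ennreal t * rearrangement M f t"
    using assms unfolding osc_mass_def
    by (subst nn_integral_add, measurable) (simp add: nn_integral_const_Ioo)
  finally show ?thesis .
qed

lemma rearrangement_mass_mono: "mono (rearrangement_mass M f)"
  unfolding rearrangement_mass_def
  by (intro monoI nn_integral_mono) (auto split: split_indicator)

lemma borel_measurable_rearrangement_mass [measurable]: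
  "rearrangement_mass M f \<in> borel_measurable borel"
  by (intro borel_measurable_ennreal_mono rearrangement_mass_mono)

lemma rearrangement_le_mass: "0 < t \<Longrightarrow> ennreal t * rearrangement M f t \<le> rearrangement_mass M f t"
  unfolding rearrangement_mass_def
  by (subst nn_integral_const_Ioo[symmetric])
    (auto intro!: nn_integral_mono rearrangement_mono split: split_indicator)

lemma nn_integral_half_dilation:
  fixes h :: "real \<Rightarrow> ennreal"
  assumes [measurable]: "h \<in> borel_measurable borel"
  shows "(\<integral>\<^sup>+ r \<in> {0<..<t}. h (r / 2) \<partial>lebesgue) = 2 * (\<integral>\<^sup>+ r \<in> {0<..<t / 2}. h r \<partial>lebesgue)"
proof -
  have "(\<integral>\<^sup>+ r \<in> {0<..<t}. h (r / 2) \<partial>lebesgue) =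
      ennreal \<bar>2\<bar> * (\<integral>\<^sup>+ r. h ((0 + 2 * r) / 2) * indicator {0<..<t} (0 + 2 * r) \<partial>lebesgue)"
    by (rule nn_integral_real_affine_lebesgue) auto
  also have "\<dots> = 2 * (\<integral>\<^sup>+ r \<in> {0<..<t / 2}. h r \<partial>lebesgue)"
    by (auto intro!: arg_cong2[where f = times] nn_integral_cong split: split_indicator)
  finally show ?thesis .
qed

text \<open>The subtracted value f*(t) has to be bounded from below; reading f1 as f - f0 does so at
  the price of the argument 2 t. The value f*(r) is split at r / 2, and undoing this dilation costs
  a factor 2. Hence the coefficient 2 of the oscillation, and 3 = 2 + 1, the 1 coming from t
  f0*(t).\<close>

lemma osc_mass_add_le:
  assumes f0 [measurable]: "f0 \<in> borel_measurable M" and f1 [measurable]: "f1 \<in> borel_measurable M"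
    and f [measurable]: "f \<in> borel_measurable M"
    and dec: "decomposes M f f0 f1" and t: "0 < t"
    and fin0: "\<And>s. 0 < s \<Longrightarrow> rearrangement M f0 s < \<infinity>"
    and fin: "\<And>s. 0 < s \<Longrightarrow> rearrangement M f s < \<infinity>"
  shows "osc_mass M f t \<le> 3 * rearrangement_mass M f0 t + 2 * osc_mass M f1 (2 * t)"
proof -
  let ?R = "rearrangement M"
  have dec1: "decomposes M f1 f (\<lambda>x. - f0 x)" using dec by (simp add: decomposes_def)
  have shift: "?R f1 (2 * t) \<le> ?R f t + ?R f0 t"
    using rearrangement_add_le[OF f _ dec1, of t t] t fin by (simp add: rearrangement_uminus)
  have pw: "?R f r - ?R f t \<le> ?R f0 (r / 2) + ?R f0 t + (?R f1 (r / 2) - ?R f1 (2 * t))"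
    if r: "0 < r" "r < t" for r
  proof -
    have "?R f r \<le> ?R f0 (r / 2) + ?R f1 (r / 2)"
      using rearrangement_add_le[OF f0 f1 dec, of "r / 2" "r / 2"] r fin0 by simp
    also have "?R f1 (r / 2) = ?R f1 (2 * t) + (?R f1 (r / 2) - ?R f1 (2 * t))"
      using r by (intro ennreal_ineq_diff_add rearrangement_mono) auto
    also have "\<dots> \<le> (?R f t + ?R f0 t) + (?R f1 (r / 2) - ?R f1 (2 * t))"
      by (intro add_right_mono shift)
    finally have "?R f r \<le> ?R f t + (?R f0 (r / 2) + ?R f0 t + (?R f1 (r / 2) - ?R f1 (2 * t)))"
      by (simp add: add_ac add_left_mono)
    then show ?thesis using fin[OF t] by (auto simp: ennreal_minus_le_iff)
  qed
  have "osc_mass M f t \<le> (\<integral>\<^sup>+ r. ?R f0 (r / 2) * indicator {0<..<t} r + ?R f0 t * indicator {0<..<t} r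
      + (?R f1 (r / 2) - ?R f1 (2 * t)) * indicator {0<..<t} r \<partial>lebesgue)"
    unfolding osc_mass_def by (intro nn_integral_mono) (auto split: split_indicator intro: pw)
  also have "\<dots> = (\<integral>\<^sup>+ r \<in> {0<..<t}. ?R f0 (r / 2) \<partial>lebesgue) + (\<integral>\<^sup>+ r \<in> {0<..<t}. ?R f0 t \<partial>lebesgue)
      + (\<integral>\<^sup>+ r \<in> {0<..<t}. (?R f1 (r / 2) - ?R f1 (2 * t)) \<partial>lebesgue)"
    by (subst nn_integral_add, measurable, subst nn_integral_add, measurable)
  also have "\<dots> = 2 * rearrangement_mass M f0 (t / 2) + ennreal t * ?R f0 t
      + 2 * (\<integral>\<^sup>+ r \<in> {0<..<t / 2}. (?R f1 r - ?R f1 (2 * t)) \<partial>lebesgue)"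
    using t by (simp add: nn_integral_half_dilation[of "?R f0"] rearrangement_mass_def nn_integral_const_Ioo
        nn_integral_half_dilation[of "\<lambda>r. ?R f1 r - ?R f1 (2 * t)"])
  also have "\<dots> \<le> 2 * rearrangement_mass M f0 t + rearrangement_mass M f0 t + 2 * osc_mass M f1 (2 * t)"
  proof (intro add_mono mult_left_mono)
    show "rearrangement_mass M f0 (t / 2) \<le> rearrangement_mass M f0 t"
      using t by (intro monoD[OF rearrangement_mass_mono]) auto
    show "ennreal t * ?R f0 t \<le> rearrangement_mass M f0 t" by (rule rearrangement_le_mass[OF t])
    show "(\<integral>\<^sup>+ r \<in> {0<..<t / 2}. (?R f1 r - ?R f1 (2 * t)) \<partial>lebesgue) \<le> osc_mass M f1 (2 * t)"
      unfolding osc_mass_def using t by (intro nn_integral_mono) (auto split: split_indicator)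
  qed auto
  also have "2 * rearrangement_mass M f0 t + rearrangement_mass M f0 t = 3 * rearrangement_mass M f0 t"
    by (cases "rearrangement_mass M f0 t") (auto simp: numeral_mult_ennreal ennreal_plus[symmetric] ennreal_mult_top simp del: ennreal_plus)
  finally show ?thesis .
qed

text \<open>For s \<le> t the constant f*(t) cancels in the difference. For s > t the rearrangement
  of the upper part vanishes from t on, which cuts the integral at t.\<close>

lemma osc_mass_truncate_above_le:
  assumes f0: "\<And>s. rearrangement M f0 s = rearrangement M f s - rearrangement M f t"
    and fin: "\<And>s. 0 < s \<Longrightarrow> rearrangement M f s < \<infinity>" and "0 < t" "0 < s"
  shows "osc_mass M f0 s \<le> osc_mass M f (min s t)"
  unfolding osc_mass_def f0
proof (rule nn_integral_mono)
  fix r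
  let ?R = "rearrangement M f"
  show "(?R r - ?R t - (?R s - ?R t)) * indicator {0<..<s} r \<le>
      (?R r - ?R (min s t)) * indicator {0<..<min s t} r"
  proof (cases "0 < r \<and> r < s")
    case True
    show ?thesis
    proof (cases "s \<le> t")
      case st: True
      have "?R t \<le> ?R s" using st by (rule rearrangement_mono)
      then have "?R r - ?R t - (?R s - ?R t) \<le> ?R r - ?R s"
        using fin[OF \<open>0 < s\<close>] fin[OF \<open>0 < t\<close>]
        by (simp add: diff_add_eq_diff_diff_swap_ennreal[symmetric] add_diff_self_ennreal)
      then show ?thesis using True st by (simp add: min_def)
    next
      case False
      show ?thesis
      proof (cases "r < t")
        case True
        then show ?thesis using False \<open>0 < r \<and> r < s\<close> by (simp add: min_def)
      next
        case rt: False
        then have "?R r - ?R t = 0"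
          using fin[of r] True by (intro diff_eq_0_ennreal rearrangement_mono) auto
        then show ?thesis by simp
      qed
    qed
  qed auto
qed

text \<open>Up to t the rearrangement of the lower part is the constant f*(t) and does not
  oscillate; beyond t the same f*(s) is subtracted from something smaller.\<close>

lemma osc_mass_truncate_below_le:
  assumes f1: "\<And>s. rearrangement M f1 s = min (rearrangement M f t) (rearrangement M f s)"
    and fin: "rearrangement M f t < \<infinity>"
  shows "osc_mass M f1 s \<le> (if s \<le> t then 0 else osc_mass M f s)"
proof (cases "s \<le> t")
  case True
  have "osc_mass M f1 s = (\<integral>\<^sup>+ r. 0 \<partial>(lebesgue :: real measure))"
    unfolding osc_mass_def f1
  proof (rule nn_integral_cong)
    fix r
    have "min (rearrangement M f t) (rearrangement M f u) = rearrangement M f t" if "u \<le> t" for u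
      using rearrangement_mono[OF that, of M f] by (simp add: min_def)
    then show "(min (rearrangement M f t) (rearrangement M f r) - min (rearrangement M f t) (rearrangement M f s)) *
        indicator {0<..<s} r = 0"
      using True fin by (auto split: split_indicator)
  qed
  then show ?thesis using True by simp
next
  case False
  then have "rearrangement M f s \<le> rearrangement M f t" by (intro rearrangement_mono) auto
  then have "osc_mass M f1 s \<le> osc_mass M f s"
    unfolding osc_mass_def f1
    by (intro nn_integral_mono) (auto split: split_indicator simp: min_absorb2 intro: ennreal_minus_mono)
  with False show ?thesis by simp
qed

text \<open>The factor s^(-p) absorbs the division by s in the oscillation, so norms become
  integrals of powers of \<open>osc_mass\<close> and tails become powers of \<open>psi\<close>. The
  indicator makes it measurable on the whole line, since nothing is known about w outside (0,
  \<infinity>).\<close>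

definition scaled_weight :: "real \<Rightarrow> (real \<Rightarrow> ennreal) \<Rightarrow> real \<Rightarrow> ennreal" where
  "scaled_weight p w s = ennreal (s powr (- p)) * w s * indicator {0<..} s"

lemma borel_measurable_scaled_weight:
  assumes "weight w"
  shows "scaled_weight p w \<in> borel_measurable lebesgue"
proof -
  have [measurable]: "(\<lambda>s. w s * indicator {0<..} s) \<in> borel_measurable lebesgue"
    using assms unfolding weight_def
    by (subst (asm) borel_measurable_restrict_space_iff_ennreal) auto
  have "scaled_weight p w = (\<lambda>s. ennreal (s powr (- p)) * (w s * indicator {0<..} s))"
    by (auto simp: scaled_weight_def mult.assoc)
  then show ?thesis by simp
qed

lemma psi_eq:
  assumes "0 < t"
  shows "psi p w t = enn_powr (tail (scaled_weight p w) t) (1 / p)"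
  using assms unfolding psi_def tail_def scaled_weight_def
  by (intro arg_cong2[where f = enn_powr] nn_integral_cong refl) (auto split: split_indicator)

lemma nn_integral_osc_eq:
  assumes "0 < p" and fin: "\<And>s. 0 < s \<Longrightarrow> rearrangement M f s < \<infinity>" and A: "A \<subseteq> {0<..}"
  shows "(\<integral>\<^sup>+ s \<in> A. enn_powr (osc M f s) p * w s \<partial>lebesgue) =
    (\<integral>\<^sup>+ s \<in> A. enn_powr (osc_mass M f s) p * scaled_weight p w s \<partial>lebesgue)"
proof (rule nn_integral_cong)
  fix s
  show "enn_powr (osc M f s) p * w s * indicator A s =
    enn_powr (osc_mass M f s) p * scaled_weight p w s * indicator A s"
  proof (cases "s \<in> A")
    case True
    then have s: "0 < s" using A by auto
    have "osc M f s = osc_mass M f s * ennreal (1 / s)"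
      using osc_eq[OF s fin[OF s]] s by (simp add: divide_ennreal_def inverse_ennreal inverse_eq_divide)
    then have "enn_powr (osc M f s) p = enn_powr (osc_mass M f s) p * ennreal (s powr (- p))"
      using s \<open>0 < p\<close> by (simp add: enn_powr_mult enn_powr_ennreal powr_divide powr_minus_divide)
    then show ?thesis using s by (simp add: scaled_weight_def mult_ac)
  qed simp
qed

section \<open>The two bounds for the K-functional\<close>

lemma enn_powr_root_le:
  fixes I X Y :: ennreal and c p :: real
  assumes p: "0 < p" and c: "0 \<le> c" and I: "I \<le> ennreal c * (enn_powr X p + enn_powr Y p)"
  shows "enn_powr I (1 / p) \<le> ennreal ((2 * c) powr (1 / p)) * (X + Y)"
proof -
  have "I \<le> ennreal c * (enn_powr (X + Y) p + enn_powr (X + Y) p)"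
    using I p by (auto intro!: order_trans[OF I] mult_left_mono add_mono enn_powr_mono)
  also have "\<dots> = ennreal (2 * c) * enn_powr (X + Y) p"
    using c by (simp add: mult_2[symmetric] ennreal_mult mult_ac)
  finally have "enn_powr I (1 / p) \<le> enn_powr (ennreal (2 * c) * enn_powr (X + Y) p) (1 / p)"
    using p by (intro enn_powr_mono) auto
  also have "\<dots> = ennreal ((2 * c) powr (1 / p)) * (X + Y)"
    using p c by (simp only: enn_powr_mult enn_powr_powr_inverse enn_powr_ennreal zero_less_divide_1_iff mult_nonneg_nonneg zero_le_numeral)
  finally show ?thesis .
qed

lemma enn_powr_mult_tail_le:
  assumes F: "mono F" and p: "0 < p" and [measurable]: "v \<in> borel_measurable lebesgue"
  shows "enn_powr (F t) p * tail v t \<le> (\<integral>\<^sup>+ s \<in> {t<..}. enn_powr (F s) p * v s \<partial>lebesgue)"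
proof -
  have "enn_powr (F t) p * tail v t = (\<integral>\<^sup>+ s. enn_powr (F t) p * (v s * indicator {t<..} s) \<partial>lebesgue)"
    unfolding tail_def by (rule nn_integral_cmult[symmetric]) measurable
  also have "\<dots> \<le> (\<integral>\<^sup>+ s \<in> {t<..}. enn_powr (F s) p * v s \<partial>lebesgue)"
    using p by (intro nn_integral_mono)
      (auto split: split_indicator intro!: mult_right_mono enn_powr_mono monoD[OF F])
  finally show ?thesis .
qed

lemma nn_integral_enn_powr_add_le:
  fixes c1 c2 p :: real
  assumes p: "0 < p" and c: "0 \<le> c1" "0 \<le> c2"
    and [measurable]: "v \<in> borel_measurable lebesgue" "N \<in> borel_measurable lebesgue"
      "G \<in> borel_measurable lebesgue" "A \<in> sets lebesgue"
    and le: "\<And>s. s \<in> A \<Longrightarrow> F s \<le> ennreal c1 * N s + ennreal c2 * G s"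
  shows "(\<integral>\<^sup>+ s \<in> A. enn_powr (F s) p * v s \<partial>lebesgue) \<le>
    ennreal ((2 * c1) powr p) * (\<integral>\<^sup>+ s \<in> A. enn_powr (N s) p * v s \<partial>lebesgue) +
    ennreal ((2 * c2) powr p) * (\<integral>\<^sup>+ s \<in> A. enn_powr (G s) p * v s \<partial>lebesgue)"
proof -
  have "(\<integral>\<^sup>+ s \<in> A. enn_powr (F s) p * v s \<partial>lebesgue) \<le>
    (\<integral>\<^sup>+ s. ennreal ((2 * c1) powr p) * (enn_powr (N s) p * v s * indicator A s) +
      ennreal ((2 * c2) powr p) * (enn_powr (G s) p * v s * indicator A s) \<partial>lebesgue)"
  proof (rule nn_integral_mono)
    fix s
    show "enn_powr (F s) p * v s * indicator A s \<le>
      ennreal ((2 * c1) powr p) * (enn_powr (N s) p * v s * indicator A s) +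
      ennreal ((2 * c2) powr p) * (enn_powr (G s) p * v s * indicator A s)"
    proof (cases "s \<in> A")
      case True
      have "enn_powr (F s) p \<le> enn_powr (ennreal c1 * N s + ennreal c2 * G s) p"
        using p le[OF True] by (rule enn_powr_mono)
      also have "\<dots> \<le> ennreal (2 powr p) * (enn_powr (ennreal c1 * N s) p + enn_powr (ennreal c2 * G s) p)"
        using p by (rule enn_powr_add_le)
      also have "\<dots> = ennreal ((2 * c1) powr p) * enn_powr (N s) p + ennreal ((2 * c2) powr p) * enn_powr (G s) p"
        using p c by (simp add: enn_powr_mult enn_powr_ennreal powr_mult ennreal_mult distrib_left mult_ac)
      finally have "enn_powr (F s) p * v s \<le>
          (ennreal ((2 * c1) powr p) * enn_powr (N s) p + ennreal ((2 * c2) powr p) * enn_powr (G s) p) * v s"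
        by (rule mult_right_mono) simp
      then show ?thesis using True by (simp add: distrib_right distrib_left mult_ac)
    qed simp
  qed
  also have "\<dots> = ennreal ((2 * c1) powr p) * (\<integral>\<^sup>+ s \<in> A. enn_powr (N s) p * v s \<partial>lebesgue) +
    ennreal ((2 * c2) powr p) * (\<integral>\<^sup>+ s \<in> A. enn_powr (G s) p * v s \<partial>lebesgue)"
    by (subst nn_integral_add, measurable, subst nn_integral_cmult, measurable, subst nn_integral_cmult) measurable
  finally show ?thesis .
qed

text \<open>In the application a and b are \<psi>0 and \<psi>1, and \<beta> comes from the norm of
  f1. Up to the factor a^(-1-\<epsilon>), 1 / b is the quasi-nondecreasing function of
  \<open>qm\<close>, which is replaced by its value at t; the remaining power of the tail of v0 is
  integrable toward 0.\<close>

lemma nn_integral_near_0_le: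
  fixes a b :: "real \<Rightarrow> real" and p0 \<epsilon> K t :: real
  assumes [measurable]: "v0 \<in> borel_measurable lebesgue"
    and p0: "0 < p0" and \<epsilon>: "0 < \<epsilon>" and K: "0 < K"
    and a: "\<And>s. 0 < s \<Longrightarrow> 0 < a s \<and> tail v0 s = ennreal (a s powr p0)" and b: "\<And>s. 0 < s \<Longrightarrow> 0 < b s"
    and qm: "\<And>s t. 0 < s \<Longrightarrow> s \<le> t \<Longrightarrow> a s / b s * a s powr \<epsilon> \<le> K * (a t / b t * a t powr \<epsilon>)"
    and \<beta>: "0 \<le> \<beta>" and G: "\<And>s. 0 < s \<Longrightarrow> G s \<le> ennreal (\<beta> / b s)" and t: "0 < t"
  shows "(\<integral>\<^sup>+ s \<in> {0<..<t}. enn_powr (G s) p0 * v0 s \<partial>lebesgue) \<le>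
    ennreal (K powr p0 * (2 / (1 - 2 powr (- \<epsilon>))) * (a t / b t * \<beta>) powr p0)"
proof -
  \<comment> \<open>Collects what depends on t alone: \<beta> / b(s) will be at most c
    a(s)^(-1-\<epsilon>) on (0, t).\<close>
  define c where "c = \<beta> * (K * (a t / b t * a t powr \<epsilon>))"
  have at: "0 < a t" "0 < b t" using a b t by auto
  then have c: "0 \<le> c" using K \<beta> by (simp add: c_def)
  have pw: "enn_powr (G s) p0 \<le> ennreal (c powr p0) * ennreal (enn2real (tail v0 s) powr (- (1 + \<epsilon>)))"
    if s: "0 < s" "s < t" for s
  proof -
    have as: "0 < a s" "0 < b s" using a b s by auto
    have "\<beta> / b s = \<beta> * (a s / b s * a s powr \<epsilon>) * a s powr (- (1 + \<epsilon>))"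
    proof -
      have "a s * a s powr \<epsilon> * a s powr (- (1 + \<epsilon>)) = a s powr (1 + \<epsilon> + - (1 + \<epsilon>))"
        using as unfolding powr_add by simp
      then have "a s * a s powr \<epsilon> * a s powr (- (1 + \<epsilon>)) = 1" using as by simp
      then show ?thesis by (simp add: mult_ac)
    qed
    also have "\<dots> \<le> c * a s powr (- (1 + \<epsilon>))"
      unfolding c_def using s \<beta> by (intro mult_right_mono mult_left_mono qm) auto
    finally have "enn_powr (G s) p0 \<le> enn_powr (ennreal (c * a s powr (- (1 + \<epsilon>)))) p0"
      using G[OF s(1)] p0 by (intro enn_powr_mono) (auto intro: order_trans ennreal_leI)
    also have "\<dots> = ennreal (c powr p0 * (a s powr p0) powr (- (1 + \<epsilon>)))"
      using c as by (simp add: enn_powr_ennreal powr_mult powr_powr mult.commute)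
    also have "\<dots> = ennreal (c powr p0) * ennreal (enn2real (tail v0 s) powr (- (1 + \<epsilon>)))"
      using a s by (simp add: ennreal_mult)
    finally show ?thesis .
  qed
  have "(\<integral>\<^sup>+ s \<in> {0<..<t}. enn_powr (G s) p0 * v0 s \<partial>lebesgue) \<le>
    (\<integral>\<^sup>+ s. ennreal (c powr p0) * (ennreal (enn2real (tail v0 s) powr (- (1 + \<epsilon>))) * v0 s * indicator {0<..<t} s) \<partial>lebesgue)"
    using pw by (intro nn_integral_mono) (auto split: split_indicator simp: mult.assoc[symmetric] intro!: mult_right_mono)
  also have "\<dots> = ennreal (c powr p0) *
      (\<integral>\<^sup>+ s \<in> {0<..<t}. ennreal (enn2real (tail v0 s) powr (- (1 + \<epsilon>))) * v0 s \<partial>lebesgue)"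
    by (rule nn_integral_cmult) measurable
  also have "\<dots> \<le> ennreal (c powr p0) * ennreal (2 / (1 - 2 powr (- \<epsilon>)) * enn2real (tail v0 t) powr (- \<epsilon>))"
  proof (intro mult_left_mono nn_integral_powr_tail_near_0 \<epsilon> t)
    show "0 < tail v0 t" using a[OF t] by simp
    show "tail v0 s < \<infinity>" if "0 < s" for s using a[OF that] by simp
  qed auto
  also have "\<dots> = ennreal (c powr p0 * (2 / (1 - 2 powr (- \<epsilon>)) * enn2real (tail v0 t) powr (- \<epsilon>)))"
    by (rule ennreal_mult[symmetric]) (use \<epsilon> in \<open>auto simp: powr_less_one less_imp_le\<close>)
  also have "c powr p0 * (2 / (1 - 2 powr (- \<epsilon>)) * enn2real (tail v0 t) powr (- \<epsilon>)) =
      K powr p0 * (2 / (1 - 2 powr (- \<epsilon>))) * (a t / b t * \<beta>) powr p0"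
  proof -
    have "c = K * (a t / b t * \<beta>) * a t powr \<epsilon>" by (simp add: c_def)
    then have "c powr p0 = K powr p0 * (a t / b t * \<beta>) powr p0 * (a t powr \<epsilon>) powr p0"
      using K at \<beta> by (simp only: powr_mult)
    \<comment> \<open>The power a(t)^\<epsilon> brought in by quasi-monotonicity cancels against the
      tail power, leaving \<theta>(t) \<beta>.\<close>
    moreover have "(a t powr \<epsilon>) powr p0 * (a t powr p0) powr (- \<epsilon>) = 1"
      using at by (simp add: powr_powr mult.commute powr_add[symmetric])
    ultimately show ?thesis using a[OF t] by (simp add: field_simps)
  qed
  finally show ?thesis .
qed

text \<open>The same quasi-monotonicity solved for 1 / a: since a^(1+\<epsilon>) / b is
  quasi-nondecreasing, the power \<delta> bounds 1 / a(s) by b(s)^(-\<delta>) times a quantity at t.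
  As \<delta> < 1, the resulting power of the tail of v1 is integrable toward infinity.\<close>

lemma nn_integral_near_infinity_le:
  fixes a b :: "real \<Rightarrow> real" and p1 \<epsilon> K t :: real
  assumes [measurable]: "v1 \<in> borel_measurable lebesgue"
    and p1: "0 < p1" and \<epsilon>: "0 < \<epsilon>" and K: "0 < K"
    and a: "\<And>s. 0 < s \<Longrightarrow> 0 < a s" and b: "\<And>s. 0 < s \<Longrightarrow> 0 < b s \<and> tail v1 s = ennreal (b s powr p1)"
    and qm: "\<And>s t. 0 < s \<Longrightarrow> s \<le> t \<Longrightarrow> a s / b s * a s powr \<epsilon> \<le> K * (a t / b t * a t powr \<epsilon>)"
    and \<beta>: "0 \<le> \<beta>" and N: "\<And>s. 0 < s \<Longrightarrow> N s \<le> ennreal (\<beta> / a s)" and t: "0 < t"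
  defines "\<delta> \<equiv> 1 / (1 + \<epsilon>)"
  shows "(\<integral>\<^sup>+ s \<in> {t<..}. enn_powr (N s) p1 * v1 s \<partial>lebesgue) \<le>
    ennreal ((K powr \<delta>) powr p1 * (2 / (1 - 2 powr (\<delta> - 1))) * (b t / a t * \<beta>) powr p1)"
proof -
  have \<delta>: "0 < \<delta>" "\<delta> < 1" "(1 + \<epsilon>) * \<delta> = 1" using \<epsilon> by (auto simp: \<delta>_def)
  define c where "c = \<beta> * (K powr \<delta> * b t powr \<delta> / a t)"
  have at: "0 < a t" "0 < b t" using a b t by auto
  then have c: "0 \<le> c" using K \<beta> by (simp add: c_def)
  have pw: "enn_powr (N s) p1 \<le> ennreal (c powr p1) * ennreal (enn2real (tail v1 s) powr (- \<delta>))"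
    if s: "t < s" for s
  proof -
    have s0: "0 < s" using s t by simp
    have as: "0 < a s" "0 < b s" using a b s0 by auto
    have "a t powr (1 + \<epsilon>) / b t \<le> K * (a s powr (1 + \<epsilon>) / b s)"
      using qm[OF t less_imp_le[OF s]] at as by (simp add: powr_add)
    then have "a t powr (1 + \<epsilon>) * b s \<le> K * b t * a s powr (1 + \<epsilon>)"
      using at as by (simp add: field_simps)
    then have "(a t powr (1 + \<epsilon>) * b s) powr \<delta> \<le> (K * b t * a s powr (1 + \<epsilon>)) powr \<delta>"
      using as \<delta> by (intro powr_mono2) auto
    then have "a t * b s powr \<delta> \<le> K powr \<delta> * b t powr \<delta> * a s"
      using at as K \<delta> by (simp add: powr_mult powr_powr)
    then have "1 / a s \<le> (K powr \<delta> * b t powr \<delta> / a t) * b s powr (- \<delta>)"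
      using at as by (simp add: powr_minus field_simps)
    then have "\<beta> * (1 / a s) \<le> \<beta> * ((K powr \<delta> * b t powr \<delta> / a t) * b s powr (- \<delta>))"
      using \<beta> by (rule mult_left_mono)
    then have "\<beta> / a s \<le> c * b s powr (- \<delta>)" by (simp add: c_def)
    then have "enn_powr (N s) p1 \<le> enn_powr (ennreal (c * b s powr (- \<delta>))) p1"
      using N[OF s0] p1 by (intro enn_powr_mono) (auto intro: order_trans ennreal_leI)
    also have "\<dots> = ennreal (c powr p1 * (b s powr p1) powr (- \<delta>))"
      using c as by (simp add: enn_powr_ennreal powr_mult powr_powr mult.commute)
    also have "\<dots> = ennreal (c powr p1) * ennreal (enn2real (tail v1 s) powr (- \<delta>))"
      using b s0 by (simp add: ennreal_mult)
    finally show ?thesis .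
  qed
  have "(\<integral>\<^sup>+ s \<in> {t<..}. enn_powr (N s) p1 * v1 s \<partial>lebesgue) \<le>
    (\<integral>\<^sup>+ s. ennreal (c powr p1) * (ennreal (enn2real (tail v1 s) powr (- \<delta>)) * v1 s * indicator {t<..} s) \<partial>lebesgue)"
    using pw by (intro nn_integral_mono) (auto split: split_indicator simp: mult.assoc[symmetric] intro!: mult_right_mono)
  also have "\<dots> = ennreal (c powr p1) *
      (\<integral>\<^sup>+ s \<in> {t<..}. ennreal (enn2real (tail v1 s) powr (- \<delta>)) * v1 s \<partial>lebesgue)"
    by (rule nn_integral_cmult) measurable
  also have "\<dots> \<le> ennreal (c powr p1) * ennreal (2 / (1 - 2 powr (\<delta> - 1)) * enn2real (tail v1 t) powr (1 - \<delta>))"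
  proof (intro mult_left_mono nn_integral_powr_tail_near_infinity \<delta> t)
    show "tail v1 t < \<infinity>" using b[OF t] by simp
    show "0 < tail v1 s" if "0 < s" for s using b[OF that] by simp
  qed auto
  also have "\<dots> = ennreal (c powr p1 * (2 / (1 - 2 powr (\<delta> - 1)) * enn2real (tail v1 t) powr (1 - \<delta>)))"
    by (rule ennreal_mult[symmetric]) (use \<delta> in \<open>auto simp: powr_less_one less_imp_le\<close>)
  also have "c powr p1 * (2 / (1 - 2 powr (\<delta> - 1)) * enn2real (tail v1 t) powr (1 - \<delta>)) =
      (K powr \<delta>) powr p1 * (2 / (1 - 2 powr (\<delta> - 1))) * (b t / a t * \<beta>) powr p1"
  proof -
    \<comment> \<open>The exponents \<delta> and 1 - \<delta> of b(t) recombine to 1, so the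
      reciprocal of \<theta>(t) appears.\<close>
    have "c * b t powr (1 - \<delta>) = K powr \<delta> * (b t / a t * \<beta>)"
      using at by (simp add: c_def powr_add[symmetric])
    then have "(c * b t powr (1 - \<delta>)) powr p1 = (K powr \<delta>) powr p1 * (b t / a t * \<beta>) powr p1"
      using K at \<beta> by (simp only: powr_mult)
    moreover have "(b t powr (1 - \<delta>)) powr p1 = (b t powr p1) powr (1 - \<delta>)"
      using at by (simp add: powr_powr mult.commute)
    ultimately have "c powr p1 * (b t powr p1) powr (1 - \<delta>) = (K powr \<delta>) powr p1 * (b t / a t * \<beta>) powr p1"
      using c at by (simp add: powr_mult)
    then show ?thesis using b[OF t] by (simp add: mult_ac)
  qed
  finally show ?thesis .
qed

section \<open>Consequences of doubling and pointwise bounds by \<open>psi\<close>\<close>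

lemma psi_antimono:
  assumes "0 < p" "s \<le> t"
  shows "psi p w t \<le> psi p w s"
  unfolding psi_def using assms
  by (intro enn_powr_mono nn_integral_mono) (auto split: split_indicator)

text \<open>By doubling, a zero at t propagates to every t / 2^n, against \<psi>(0+) =
  \<infinity>.\<close>

lemma psi_pos:
  fixes C :: real
  assumes lim: "(psi p w \<longlongrightarrow> \<infinity>) (at_right 0)"
    and dbl: "\<And>t. 0 < t \<Longrightarrow> psi p w t \<le> ennreal C * psi p w (2 * t)" and t: "0 < t"
  shows "0 < psi p w t"
proof (rule ccontr)
  assume "\<not> 0 < psi p w t"
  then have z: "psi p w (t / 2 ^ n) = 0" for n
  proof (induction n)
    case (Suc n)
    have "psi p w (t / 2 ^ Suc n) \<le> ennreal C * psi p w (2 * (t / 2 ^ Suc n))"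
      using t by (intro dbl) simp
    with Suc show ?case by simp
  qed simp
  have "eventually (\<lambda>s. 0 < psi p w s) (at_right 0)"
    using lim by (rule order_tendstoD) simp
  then obtain b where b: "0 < b" "\<And>s. 0 < s \<Longrightarrow> s < b \<Longrightarrow> 0 < psi p w s"
    by (auto simp: eventually_at_right_field)
  obtain n where "(1 / 2) ^ n < b / t"
    using real_arch_pow_inv[of "b / t" "1 / 2"] b t by auto
  then have "t / 2 ^ n < b" using t by (simp add: field_simps power_one_over)
  with b(2)[of "t / 2 ^ n"] z[of n] t show False by simp
qed

text \<open>An infinite value propagates upward by doubling and downward by monotonicity, so \<psi>
  is finite on all of (0, \<infinity>) or nowhere.\<close>

lemma psi_top:
  fixes C :: real
  assumes p: "0 < p" and dbl: "\<And>t. 0 < t \<Longrightarrow> psi p w t \<le> ennreal C * psi p w (2 * t)"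
    and s: "0 < s" "psi p w s = top" and t: "0 < t"
  shows "psi p w t = top"
proof -
  have top: "psi p w (2 ^ n * s) = top" for n
  proof (induction n)
    case (Suc n)
    have "psi p w (2 ^ n * s) \<le> ennreal C * psi p w (2 * (2 ^ n * s))"
      using s by (intro dbl) simp
    with Suc show ?case by (auto simp: top_unique ennreal_mult_eq_top_iff mult.assoc)
  qed (use s in simp)
  obtain n where "t / s < 2 ^ n" using real_arch_pow[of 2 "t / s"] by auto
  then have "t \<le> 2 ^ n * s" using s by (simp add: field_simps)
  then show ?thesis using psi_antimono[OF p, of t "2 ^ n * s" w] top[of n] by (simp add: top_unique)
qed

lemma tail_scaled_weight_eq:
  assumes "0 < p" "0 < t"
  shows "tail (scaled_weight p w) t = enn_powr (psi p w t) p"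
  using assms by (simp add: psi_eq enn_powr_inverse_powr)

text \<open>Beyond t a nondecreasing F is at least F(t). Keeping the integral over the half-line
  instead of the whole norm is what later allows the boundary term of the upper bound to be
  absorbed.\<close>

lemma mult_psi_le:
  assumes F: "mono F" and p: "0 < p" and w: "weight w" and t: "0 < t"
  shows "F t * psi p w t \<le>
    enn_powr (\<integral>\<^sup>+ s \<in> {t<..}. enn_powr (F s) p * scaled_weight p w s \<partial>lebesgue) (1 / p)"
proof -
  have "enn_powr (F t * psi p w t) p = enn_powr (F t) p * tail (scaled_weight p w) t"
    using p t by (simp add: enn_powr_mult tail_scaled_weight_eq)
  also have "\<dots> \<le> (\<integral>\<^sup>+ s \<in> {t<..}. enn_powr (F s) p * scaled_weight p w s \<partial>lebesgue)"
    by (intro enn_powr_mult_tail_le F p borel_measurable_scaled_weight w)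
  finally have "enn_powr (enn_powr (F t * psi p w t) p) (1 / p) \<le>
    enn_powr (\<integral>\<^sup>+ s \<in> {t<..}. enn_powr (F s) p * scaled_weight p w s \<partial>lebesgue) (1 / p)"
    using p by (intro enn_powr_mono) auto
  then show ?thesis using p by (simp only: enn_powr_powr_inverse)
qed

lemma nn_integral_Ioi_le:
  "0 \<le> t \<Longrightarrow> (\<integral>\<^sup>+ s \<in> {t<..}. g s \<partial>lebesgue) \<le> (\<integral>\<^sup>+ s \<in> {0<..}. g s \<partial>lebesgue)" for t :: real
  by (intro nn_integral_mono) (auto split: split_indicator)

lemma S_spaceD:
  assumes "f \<in> S_space M p w" and p: "0 < p"
  shows "f \<in> borel_measurable M" "S_norm M p w f < \<infinity>" "(rearrangement M f \<longlongrightarrow> 0) at_top"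
    "\<And>s. 0 < s \<Longrightarrow> rearrangement M f s < \<infinity>"
    "enn_powr (S_norm M p w f) p =
      (\<integral>\<^sup>+ s \<in> {0<..}. enn_powr (osc_mass M f s) p * scaled_weight p w s \<partial>lebesgue)"
proof -
  show f: "f \<in> borel_measurable M" "S_norm M p w f < \<infinity>" "(rearrangement M f \<longlongrightarrow> 0) at_top"
    using assms by (auto simp: S_space_def)
  then show fin: "rearrangement M f s < \<infinity>" if "0 < s" for s
    using that by (intro rearrangement_less_top)
  show "enn_powr (S_norm M p w f) p =
      (\<integral>\<^sup>+ s \<in> {0<..}. enn_powr (osc_mass M f s) p * scaled_weight p w s \<partial>lebesgue)"
    unfolding S_norm_def using p fin by (simp add: enn_powr_inverse_powr nn_integral_osc_eq)
qed

lemma osc_mass_mult_psi_le: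
  assumes "f \<in> S_space M p w" and p: "0 < p" and w: "weight w" and t: "0 < t"
  shows "osc_mass M f t * psi p w t \<le> S_norm M p w f"
proof -
  have "osc_mass M f t * psi p w t \<le> enn_powr (enn_powr (S_norm M p w f) p) (1 / p)"
    unfolding S_spaceD(5)[OF assms(1) p] using p t
    by (intro order_trans[OF mult_psi_le] enn_powr_mono nn_integral_Ioi_le osc_mass_mono w) auto
  then show ?thesis using p by (simp only: enn_powr_powr_inverse)
qed

text \<open>Splitting the argument in halves bounds f*(t) by f0*(t/2) + f1*(t/2). Membership in a
  space need not survive addition; these two properties do, and they are all that is used of f
  itself.\<close>

lemma decomposes_sum:
  assumes f0: "f0 \<in> borel_measurable M" "(rearrangement M f0 \<longlongrightarrow> 0) at_top"
    and f1: "f1 \<in> borel_measurable M" "(rearrangement M f1 \<longlongrightarrow> 0) at_top"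
    and dec: "decomposes M f f0 f1"
  shows "f \<in> borel_measurable M" "(rearrangement M f \<longlongrightarrow> 0) at_top"
proof -
  show "f \<in> borel_measurable M"
    using f0 f1 dec by (subst measurable_cong[where g = "\<lambda>x. f0 x + f1 x"]) (auto simp: decomposes_def)
  have half: "filterlim (\<lambda>t::real. t / 2) at_top at_top"
    by (rule filterlim_at_top_mult_tendsto_pos[where f = "\<lambda>_. 1 / 2" and c = "1 / 2", simplified])
      (auto simp: filterlim_ident)
  have "((\<lambda>t. rearrangement M f0 (t / 2) + rearrangement M f1 (t / 2)) \<longlongrightarrow> 0 + 0) at_top"
    by (intro tendsto_add filterlim_compose[OF f0(2) half] filterlim_compose[OF f1(2) half])
  moreover have "eventually (\<lambda>t. rearrangement M f t \<le> rearrangement M f0 (t / 2) + rearrangement M f1 (t / 2)) at_top"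
    using eventually_gt_at_top[of 0]
  proof eventually_elim
    case (elim t)
    then show ?case
      using rearrangement_add_le[OF f0(1) f1(1) dec, of "t / 2" "t / 2"] rearrangement_less_top[OF f0, of "t / 2"]
      by simp
  qed
  ultimately show "(rearrangement M f \<longlongrightarrow> 0) at_top"
    using tendsto_sandwich[OF _ _ tendsto_const[of 0],
        where g = "rearrangement M f" and h = "\<lambda>t. rearrangement M f0 (t / 2) + rearrangement M f1 (t / 2)"]
    by simp
qed

text \<open>When X + Y is finite, the estimates themselves place the two truncated pieces in their
  spaces, which admits them to the infimum. The upper part contributes 2^(1/p0) to the constant and
  the lower part 1. The value \<psi>0(t) = \<infinity> is allowed.\<close>

lemma S_K_functional_le:
  fixes t :: real
  assumes p0: "0 < p0" and p1: "0 < p1" and w0: "weight w0" and w1: "weight w1"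
    and f [measurable]: "f \<in> borel_measurable M" and lim: "(rearrangement M f \<longlongrightarrow> 0) at_top"
    and t: "0 < t" and psi0: "0 < psi p0 w0 t" and psi1: "0 < psi p1 w1 t" "psi p1 w1 t < \<infinity>"
  defines "X \<equiv> enn_powr (\<integral>\<^sup>+ s \<in> {0<..<t}. enn_powr (osc M f s) p0 * w0 s \<partial>lebesgue) (1 / p0)"
    and "Y \<equiv> theta p0 w0 p1 w1 t *
      enn_powr (\<integral>\<^sup>+ s \<in> {t<..}. enn_powr (osc M f s) p1 * w1 s \<partial>lebesgue) (1 / p1)"
  shows "S_K_functional M p0 w0 p1 w1 f (theta p0 w0 p1 w1 t) \<le> ennreal (2 powr (1 / p0) + 1) * (X + Y)"
proof (cases "X + Y = \<infinity>")
  case True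
  have "ennreal (2 powr (1 / p0) + 1) * (X + Y) = top"
    unfolding True by (simp add: ennreal_mult_top)
  then show ?thesis by simp
next
  case False
  have fin: "rearrangement M f s < \<infinity>" if "0 < s" for s
    using rearrangement_less_top[OF f lim that] .
  define v0 where "v0 = scaled_weight p0 w0"
  define v1 where "v1 = scaled_weight p1 w1"
  have [measurable]: "v0 \<in> borel_measurable lebesgue" "v1 \<in> borel_measurable lebesgue"
    unfolding v0_def v1_def by (intro borel_measurable_scaled_weight w0 w1)+
  define G where "G = osc_mass M f"
  have [measurable]: "G \<in> borel_measurable borel" unfolding G_def by measurable
  define c where "c = enn2real (rearrangement M f t)"
  have c: "0 \<le> c" "ennreal c = rearrangement M f t" using fin[OF t] by (auto simp: c_def)
  \<comment> \<open>Clamping to [-c, c] gives both pieces the sign of f, so |f| splits additively at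
    the height c = f*(t).\<close>
  define f1 where "f1 x = max (- c) (min c (f x))" for x
  define f0 where "f0 x = f x - f1 x" for x
  have [measurable]: "f1 \<in> borel_measurable M" unfolding f1_def by measurable
  then have [measurable]: "f0 \<in> borel_measurable M" unfolding f0_def by measurable
  have R0: "rearrangement M f0 s = rearrangement M f s - rearrangement M f t" for s
    unfolding c(2)[symmetric] using c(1) by (intro rearrangement_truncate_above) (auto simp: f0_def f1_def)
  have R1: "rearrangement M f1 s = min (rearrangement M f t) (rearrangement M f s)" for s
    unfolding c(2)[symmetric] using c(1) by (intro rearrangement_truncate_below) (auto simp: f1_def)
  have lim0: "(rearrangement M f0 \<longlongrightarrow> 0) at_top"
    by (rule tendsto_sandwich[OF _ _ tendsto_const lim]) (auto simp: R0)
  have lim1: "(rearrangement M f1 \<longlongrightarrow> 0) at_top"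
    by (rule tendsto_sandwich[OF _ _ tendsto_const lim]) (auto simp: R1)
  have fin0: "rearrangement M f0 s < \<infinity>" and fin1: "rearrangement M f1 s < \<infinity>" if "0 < s" for s
    using fin[OF that] le_less_trans[OF diff_le_self_ennreal] by (auto simp: R0 R1 min_less_iff_disj)
  define \<theta> where "\<theta> = theta p0 w0 p1 w1 t"
  \<comment> \<open>This needs \<psi>1(t) positive and finite, a quotient by \<infinity> being 0; if
    \<psi>0(t) is infinite, so is \<theta>(t).\<close>
  have \<theta>_psi: "\<theta> * psi p1 w1 t = psi p0 w0 t"
    using psi1 unfolding \<theta>_def theta_def by (simp add: ennreal_divide_times)
  have \<theta>_pos: "0 < \<theta>"
    using psi0 psi1 unfolding \<theta>_def theta_def by (simp add: ennreal_zero_less_divide)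
  have X: "X = enn_powr (\<integral>\<^sup>+ s \<in> {0<..<t}. enn_powr (G s) p0 * v0 s \<partial>lebesgue) (1 / p0)"
    unfolding X_def G_def v0_def using p0 fin by (subst nn_integral_osc_eq) auto
  have Y: "Y = \<theta> * enn_powr (\<integral>\<^sup>+ s \<in> {t<..}. enn_powr (G s) p1 * v1 s \<partial>lebesgue) (1 / p1)"
    unfolding Y_def G_def v1_def \<theta>_def using p1 fin t by (subst nn_integral_osc_eq) auto
  have Gt: "G t * psi p0 w0 t \<le> Y"
  proof -
    have "G t * psi p0 w0 t = \<theta> * (G t * psi p1 w1 t)" by (simp add: \<theta>_psi[symmetric] mult_ac)
    also have "\<dots> \<le> Y"
      unfolding Y G_def v1_def by (intro mult_left_mono mult_psi_le osc_mass_mono p1 w1 t) auto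
    finally show ?thesis .
  qed
  have "(\<integral>\<^sup>+ s \<in> {0<..}. enn_powr (osc_mass M f0 s) p0 * v0 s \<partial>lebesgue) \<le>
    (\<integral>\<^sup>+ s. enn_powr (G s) p0 * v0 s * indicator {0<..<t} s + enn_powr (G t) p0 * (v0 s * indicator {t..} s) \<partial>lebesgue)"
  proof (rule nn_integral_mono)
    fix s
    show "enn_powr (osc_mass M f0 s) p0 * v0 s * indicator {0<..} s \<le>
      enn_powr (G s) p0 * v0 s * indicator {0<..<t} s + enn_powr (G t) p0 * (v0 s * indicator {t..} s)"
    proof (cases "0 < s")
      case True
      have "enn_powr (osc_mass M f0 s) p0 * v0 s \<le> enn_powr (G (min s t)) p0 * v0 s"
        unfolding G_def by (intro mult_right_mono enn_powr_mono p0 osc_mass_truncate_above_le R0 fin t True) auto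
      then show ?thesis using True t by (cases "s < t") (auto simp: min_absorb1 min_absorb2)
    qed simp
  qed
  \<comment> \<open>From t on the bound is frozen at G(t), so that part of the integral is a tail of
    v0 and becomes the boundary term controlled by \<open>Gt\<close>.\<close>
  also have "\<dots> = (\<integral>\<^sup>+ s \<in> {0<..<t}. enn_powr (G s) p0 * v0 s \<partial>lebesgue) + enn_powr (G t) p0 * tail v0 t"
    by (subst nn_integral_add, measurable, subst nn_integral_cmult, measurable) (simp add: nn_integral_atLeast_eq_tail)
  also have "\<dots> = ennreal 1 * (enn_powr X p0 + enn_powr (G t * psi p0 w0 t) p0)"
    unfolding X v0_def using p0 t by (simp add: enn_powr_inverse_powr enn_powr_mult tail_scaled_weight_eq)
  finally have "enn_powr (\<integral>\<^sup>+ s \<in> {0<..}. enn_powr (osc_mass M f0 s) p0 * v0 s \<partial>lebesgue) (1 / p0) \<le>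
      ennreal ((2 * 1) powr (1 / p0)) * (X + G t * psi p0 w0 t)"
    by (intro enn_powr_root_le p0) auto
  also have "\<dots> \<le> ennreal ((2 * 1) powr (1 / p0)) * (X + Y)"
    by (intro mult_left_mono add_mono Gt) auto
  finally have S0: "S_norm M p0 w0 f0 \<le> ennreal (2 powr (1 / p0)) * (X + Y)"
    unfolding S_norm_def v0_def using p0 fin0 by (subst nn_integral_osc_eq) auto
  have "(\<integral>\<^sup>+ s \<in> {0<..}. enn_powr (osc_mass M f1 s) p1 * v1 s \<partial>lebesgue) \<le>
    (\<integral>\<^sup>+ s \<in> {t<..}. enn_powr (G s) p1 * v1 s \<partial>lebesgue)"
  proof (rule nn_integral_mono)
    fix s
    have "osc_mass M f1 s \<le> (if s \<le> t then 0 else G s)"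
      unfolding G_def by (intro osc_mass_truncate_below_le R1 fin t)
    then have "enn_powr (osc_mass M f1 s) p1 \<le> enn_powr (if s \<le> t then 0 else G s) p1"
      by (intro enn_powr_mono p1)
    then show "enn_powr (osc_mass M f1 s) p1 * v1 s * indicator {0<..} s \<le> enn_powr (G s) p1 * v1 s * indicator {t<..} s"
      by (auto split: split_indicator if_splits intro: mult_right_mono)
  qed
  then have "S_norm M p1 w1 f1 \<le> enn_powr (\<integral>\<^sup>+ s \<in> {t<..}. enn_powr (G s) p1 * v1 s \<partial>lebesgue) (1 / p1)"
    unfolding S_norm_def v1_def using p1 fin1 by (subst nn_integral_osc_eq) (auto intro: enn_powr_mono)
  then have S1: "\<theta> * S_norm M p1 w1 f1 \<le> Y"
    unfolding Y by (rule mult_left_mono) simp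
  have XY: "X + Y < top" using False by (simp add: less_top)
  have "f0 \<in> S_space M p0 w0"
    unfolding S_space_def using lim0 le_less_trans[OF S0] XY by (auto simp: ennreal_mult_less_top)
  moreover have "f1 \<in> S_space M p1 w1"
  proof -
    have "\<theta> * S_norm M p1 w1 f1 < top" using S1 XY by (auto intro: le_less_trans)
    then show ?thesis
      unfolding S_space_def using lim1 \<theta>_pos by (auto simp: ennreal_mult_less_top)
  qed
  moreover have "decomposes M f f0 f1" by (simp add: decomposes_def f0_def)
  ultimately have "S_K_functional M p0 w0 p1 w1 f \<theta> \<le> S_norm M p0 w0 f0 + \<theta> * S_norm M p1 w1 f1"
    unfolding S_K_functional_def by (intro Inf_lower) auto
  also have "\<dots> \<le> ennreal (2 powr (1 / p0)) * (X + Y) + (X + Y)"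
    by (intro add_mono S0 order_trans[OF S1]) simp
  also have "\<dots> = ennreal (2 powr (1 / p0) + 1) * (X + Y)"
    by (simp add: distrib_right)
  finally show ?thesis unfolding \<theta>_def .
qed


section \<open>Lower bound for an arbitrary decomposition\<close>

lemma ennreal_le_divide_of_mult_le:
  fixes a \<beta> :: real
  assumes "x * ennreal a \<le> ennreal \<beta>" "0 < a" "0 \<le> \<beta>"
  shows "x \<le> ennreal (\<beta> / a)"
proof (cases x)
  case (real r)
  then have "r * a \<le> \<beta>" using assms by (simp add: ennreal_mult[symmetric])
  then show ?thesis using real assms by (auto intro!: ennreal_leI simp: field_simps)
next
  case top
  then show ?thesis using assms by (simp add: ennreal_top_mult top_unique)
qed

lemma RB_scaled_weight:
  assumes "RB p w"
  obtains C :: real where "0 < C"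
    "\<And>t. 0 < t \<Longrightarrow> (\<integral>\<^sup>+ s \<in> {0<..<t}. ennreal (s powr p) * scaled_weight p w s \<partial>lebesgue) \<le>
      ennreal C * ennreal (t powr p) * tail (scaled_weight p w) t"
proof -
  obtain C :: real where C: "0 < C" and RB: "\<And>t. 0 < t \<Longrightarrow> (\<integral>\<^sup>+ s \<in> {0<..<t}. w s \<partial>lebesgue) \<le>
       ennreal C * ennreal (t powr p) * (\<integral>\<^sup>+ s \<in> {t<..}. w s / ennreal (s powr p) \<partial>lebesgue)"
    using assms unfolding RB_def by blast
  show ?thesis
  proof (rule that[OF C])
    fix t :: real assume t: "0 < t"
    have "(\<integral>\<^sup>+ s \<in> {0<..<t}. ennreal (s powr p) * scaled_weight p w s \<partial>lebesgue) = (\<integral>\<^sup>+ s \<in> {0<..<t}. w s \<partial>lebesgue)"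
    proof (rule nn_integral_cong)
      fix s
      show "ennreal (s powr p) * scaled_weight p w s * indicator {0<..<t} s = w s * indicator {0<..<t} s"
      proof (cases "s \<in> {0<..<t}")
        case True
        then have "ennreal (s powr p) * ennreal (s powr (- p)) = 1"
          by (simp add: ennreal_mult[symmetric] powr_add[symmetric])
        then show ?thesis using True by (simp add: scaled_weight_def mult.assoc[symmetric])
      qed simp
    qed
    also have "\<dots> \<le> ennreal C * ennreal (t powr p) * (\<integral>\<^sup>+ s \<in> {t<..}. w s / ennreal (s powr p) \<partial>lebesgue)"
      by (rule RB[OF t])
    also have "(\<integral>\<^sup>+ s \<in> {t<..}. w s / ennreal (s powr p) \<partial>lebesgue) = tail (scaled_weight p w) t"
      unfolding tail_def
    proof (rule nn_integral_cong)
      fix s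
      show "w s / ennreal (s powr p) * indicator {t<..} s = scaled_weight p w s * indicator {t<..} s"
        using t by (auto split: split_indicator
          simp: scaled_weight_def divide_ennreal_def inverse_ennreal powr_minus mult.commute)
    qed
    finally show "(\<integral>\<^sup>+ s \<in> {0<..<t}. ennreal (s powr p) * scaled_weight p w s \<partial>lebesgue) \<le>
      ennreal C * ennreal (t powr p) * tail (scaled_weight p w) t" .
  qed
qed

text \<open>One B serves all decompositions, so the estimate passes to the infimum. With N the full
  mass of f0 and G(s) the oscillation mass of f1 at 2 s, each of the two integrals splits into a
  term with its own weight and a cross term.\<close>

lemma S_norm_sum_ge:
  fixes M :: "'a measure" and p0 p1 \<epsilon> C K :: real
  assumes p0: "0 < p0" and p1: "0 < p1" and w0: "weight w0" and w1: "weight w1"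
    and psi0: "\<And>t. 0 < t \<Longrightarrow> 0 < psi p0 w0 t \<and> psi p0 w0 t < \<infinity>"
    and psi1: "\<And>t. 0 < t \<Longrightarrow> 0 < psi p1 w1 t \<and> psi p1 w1 t < \<infinity>"
    and C: "0 < C" and dbl: "\<And>t. 0 < t \<Longrightarrow> psi p1 w1 t \<le> ennreal C * psi p1 w1 (2 * t)"
    and RB: "RB p0 w0" and \<epsilon>: "0 < \<epsilon>" and K: "0 < K"
    and quasi: "\<And>s t. 0 < s \<Longrightarrow> s \<le> t \<Longrightarrow> theta p0 w0 p1 w1 s * enn_powr (psi p0 w0 s) \<epsilon> \<le>
      ennreal K * (theta p0 w0 p1 w1 t * enn_powr (psi p0 w0 t) \<epsilon>)"
  obtains B :: real where "0 < B"
    "\<And>f f0 f1 t. f0 \<in> S_space M p0 w0 \<Longrightarrow> f1 \<in> S_space M p1 w1 \<Longrightarrow> decomposes M f f0 f1 \<Longrightarrow> 0 < t \<Longrightarrow>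
      enn_powr (\<integral>\<^sup>+ s \<in> {0<..<t}. enn_powr (osc M f s) p0 * w0 s \<partial>lebesgue) (1 / p0)
      + theta p0 w0 p1 w1 t * enn_powr (\<integral>\<^sup>+ s \<in> {t<..}. enn_powr (osc M f s) p1 * w1 s \<partial>lebesgue) (1 / p1)
      \<le> ennreal B * (S_norm M p0 w0 f0 + theta p0 w0 p1 w1 t * S_norm M p1 w1 f1)"
proof -
  define v0 where "v0 = scaled_weight p0 w0"
  define v1 where "v1 = scaled_weight p1 w1"
  have v_meas [measurable]: "v0 \<in> borel_measurable lebesgue" "v1 \<in> borel_measurable lebesgue"
    unfolding v0_def v1_def by (intro borel_measurable_scaled_weight w0 w1)+
  define a where "a s = enn2real (psi p0 w0 s)" for s
  define b where "b s = enn2real (psi p1 w1 s)" for s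
  have a: "0 < a s" "psi p0 w0 s = ennreal (a s)" if "0 < s" for s
    using psi0[OF that] by (auto simp: a_def enn2real_positive_iff)
  have b: "0 < b s" "psi p1 w1 s = ennreal (b s)" if "0 < s" for s
    using psi1[OF that] by (auto simp: b_def enn2real_positive_iff)
  have tail0: "0 < a s \<and> tail v0 s = ennreal (a s powr p0)" if "0 < s" for s
    using a[OF that] p0 that unfolding v0_def by (simp add: tail_scaled_weight_eq enn_powr_ennreal)
  have tail1: "0 < b s \<and> tail v1 s = ennreal (b s powr p1)" if "0 < s" for s
    using b[OF that] p1 that unfolding v1_def by (simp add: tail_scaled_weight_eq enn_powr_ennreal)
  have theta: "theta p0 w0 p1 w1 s = ennreal (a s / b s)" if "0 < s" for s
    using a[OF that] b[OF that] by (simp add: theta_def divide_ennreal)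
  have qm: "a s / b s * a s powr \<epsilon> \<le> K * (a t / b t * a t powr \<epsilon>)" if st: "0 < s" "s \<le> t" for s t
  proof -
    have t: "0 < t" using st by simp
    note st' = a[OF st(1)] b[OF st(1)] a[OF t] b[OF t]
    have "ennreal (a s / b s * a s powr \<epsilon>) \<le> ennreal (K * (a t / b t * a t powr \<epsilon>))"
      using quasi[OF st] st' K unfolding theta[OF st(1)] theta[OF t]
      by (simp add: enn_powr_ennreal ennreal_mult[symmetric])
    then show ?thesis using st' K by (subst (asm) ennreal_le_iff) auto
  qed
  have dbl_tail: "tail v1 (r / 2) \<le> ennreal (C powr p1) * tail v1 r" if r: "0 < r" for r
  proof -
    have "enn_powr (psi p1 w1 (r / 2)) p1 \<le> enn_powr (ennreal C * psi p1 w1 r) p1"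
      using dbl[of "r / 2"] r by (intro enn_powr_mono p1) auto
    then show ?thesis
      unfolding v1_def using p1 r C by (simp add: tail_scaled_weight_eq enn_powr_mult enn_powr_ennreal)
  qed
  obtain C' :: real where C': "0 < C'"
    "\<And>t. 0 < t \<Longrightarrow> (\<integral>\<^sup>+ s \<in> {0<..<t}. ennreal (s powr p0) * v0 s \<partial>lebesgue) \<le>
      ennreal C' * ennreal (t powr p0) * tail v0 t"
    using RB_scaled_weight[OF RB] unfolding v0_def by blast
  obtain H :: real where H: "0 < H" and hardy:
    "\<And>G R. mono G \<Longrightarrow> (\<And>s. 0 < s \<Longrightarrow> ennreal s * R s \<le> ennreal s * R (2 * s) + G (2 * s)) \<Longrightarrow>
      (R \<longlongrightarrow> 0) at_top \<Longrightarrow> (\<integral>\<^sup>+ s \<in> {0<..}. enn_powr (ennreal s * R s) p0 * v0 s \<partial>lebesgue) \<le>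
        ennreal H * (\<integral>\<^sup>+ s \<in> {0<..}. enn_powr (G s) p0 * v0 s \<partial>lebesgue)"
    using hardy_dyadic[OF v_meas(1) p0 C'] by blast
  define \<delta> where "\<delta> = 1 / (1 + \<epsilon>)"
  define K0 where "K0 = K powr p0 * (2 / (1 - 2 powr (- \<epsilon>)))"
  define K1 where "K1 = (K powr \<delta>) powr p1 * (2 / (1 - 2 powr (\<delta> - 1)))"
  have K0: "0 < K0" using K \<epsilon> by (simp add: K0_def powr_less_one)
  have K1: "0 < K1" using K \<epsilon> by (auto simp: K1_def \<delta>_def powr_less_one intro!: mult_pos_pos divide_pos_pos)
  \<comment> \<open>Bounds the weighted norm of N by that of the oscillation: 1 for the oscillation
    mass, H for s f0*(s) by the Hardy inequality, 2^p0 for the power of their sum.\<close>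
  define E where "E = 2 powr p0 * (1 + H)"
  have E: "0 < E" using H by (simp add: E_def)
  \<comment> \<open>6 = 2 * 3 and 4 = 2 * 2 combine the coefficients in \<open>osc_le\<close> with
    the 2 of the power inequality. The cross term is the second summand of c0 and the first of
    c1.\<close>
  define c0 where "c0 = 6 powr p0 * E + 4 powr p0 * (K0 * C powr p0)"
  define c1 where "c1 = 6 powr p1 * (K1 * (E powr (1 / p0)) powr p1) + 4 powr p1 * C powr p1"
  have c: "0 < c0" "0 < c1" using E K0 K1 C by (auto simp: c0_def c1_def intro!: add_pos_pos mult_pos_pos)
  define B where "B = (2 * c0) powr (1 / p0) + (2 * c1) powr (1 / p1)"
  show ?thesis
  proof (rule that[of B])
    show "0 < B" using c by (simp add: B_def add_pos_pos)
    fix f f0 f1 and t :: real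
    assume f0: "f0 \<in> S_space M p0 w0" and f1: "f1 \<in> S_space M p1 w1"
      and dec: "decomposes M f f0 f1" and t: "0 < t"
    note S0 = S_spaceD[OF f0 p0] and S1 = S_spaceD[OF f1 p1]
    note f = decomposes_sum[OF S0(1,3) S1(1,3) dec]
    have fin: "rearrangement M f s < \<infinity>" if "0 < s" for s
      using rearrangement_less_top[OF f that] .
    define b0 where "b0 = enn2real (S_norm M p0 w0 f0)"
    define b1 where "b1 = enn2real (S_norm M p1 w1 f1)"
    have b0: "S_norm M p0 w0 f0 = ennreal b0" "0 \<le> b0" using S0(2) by (auto simp: b0_def)
    have b1: "S_norm M p1 w1 f1 = ennreal b1" "0 \<le> b1" using S1(2) by (auto simp: b1_def)
    define N where "N = rearrangement_mass M f0"
    define G where "G s = osc_mass M f1 (2 * s)" for s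
    have [measurable]: "N \<in> borel_measurable borel" "G \<in> borel_measurable borel"
      unfolding N_def G_def by measurable
    have osc_le: "osc_mass M f s \<le> ennreal 3 * N s + ennreal 2 * G s" if "0 < s" for s
      using osc_mass_add_le[OF S0(1) S1(1) f(1) dec that S0(4) fin] by (simp add: N_def G_def)
    have N_int: "(\<integral>\<^sup>+ s \<in> {0<..}. enn_powr (N s) p0 * v0 s \<partial>lebesgue) \<le> ennreal (E * b0 powr p0)"
    proof -
      have I: "(\<integral>\<^sup>+ s \<in> {0<..}. enn_powr (osc_mass M f0 s) p0 * v0 s \<partial>lebesgue) = ennreal (b0 powr p0)"
        using S0(5) b0 unfolding v0_def by (simp add: enn_powr_ennreal)
      have "(\<integral>\<^sup>+ s \<in> {0<..}. enn_powr (N s) p0 * v0 s \<partial>lebesgue) \<le>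
        ennreal ((2 * 1) powr p0) * (\<integral>\<^sup>+ s \<in> {0<..}. enn_powr (osc_mass M f0 s) p0 * v0 s \<partial>lebesgue) +
        ennreal ((2 * 1) powr p0) * (\<integral>\<^sup>+ s \<in> {0<..}. enn_powr (ennreal s * rearrangement M f0 s) p0 * v0 s \<partial>lebesgue)"
        by (rule nn_integral_enn_powr_add_le[OF p0]) (auto simp: N_def intro: rearrangement_mass_le)
      also have "\<dots> \<le> ennreal (2 powr p0) * ennreal (b0 powr p0) + ennreal (2 powr p0) * (ennreal H * ennreal (b0 powr p0))"
        unfolding I[symmetric]
        using hardy[OF osc_mass_mono rearrangement_doubling_le S0(3)]
        by (intro add_mono mult_mono) auto
      also have "\<dots> = ennreal (E * b0 powr p0)"
        using H by (simp add: E_def ennreal_mult[symmetric] ennreal_plus[symmetric] algebra_simps del: ennreal_plus)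
      finally show ?thesis .
    qed
    \<comment> \<open>N is nondecreasing, so its weighted bound gives a pointwise one, the input of
      the cross term near infinity.\<close>
    have N_le: "N s \<le> ennreal (E powr (1 / p0) * b0 / a s)" if s: "0 < s" for s
    proof (rule ennreal_le_divide_of_mult_le)
      have "N s * psi p0 w0 s \<le> enn_powr (\<integral>\<^sup>+ s \<in> {s<..}. enn_powr (N s) p0 * v0 s \<partial>lebesgue) (1 / p0)"
        unfolding v0_def N_def by (intro mult_psi_le rearrangement_mass_mono p0 w0 s)
      also have "\<dots> \<le> enn_powr (ennreal (E * b0 powr p0)) (1 / p0)"
        using p0 s by (intro enn_powr_mono order_trans[OF nn_integral_Ioi_le N_int]) auto
      also have "\<dots> = ennreal (E powr (1 / p0) * b0)"
        using E b0 p0 by (simp add: enn_powr_ennreal powr_mult powr_powr)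
      finally show "N s * ennreal (a s) \<le> ennreal (E powr (1 / p0) * b0)" by (simp add: a[OF s])
    qed (use a s b0 in auto)
    \<comment> \<open>Doubling of \<psi>1 moves the pointwise bound for f1 from 2 s back to
      s.\<close>
    have G_le: "G s \<le> ennreal (C * b1 / b s)" if s: "0 < s" for s
    proof (rule ennreal_le_divide_of_mult_le)
      have "G s * psi p1 w1 s \<le> G s * (ennreal C * psi p1 w1 (2 * s))"
        by (intro mult_left_mono dbl s) auto
      also have "\<dots> = ennreal C * (osc_mass M f1 (2 * s) * psi p1 w1 (2 * s))"
        by (simp add: G_def mult_ac)
      also have "\<dots> \<le> ennreal C * S_norm M p1 w1 f1"
        using s by (intro mult_left_mono osc_mass_mult_psi_le f1 p1 w1) auto
      also have "\<dots> = ennreal (C * b1)" using C b1 by (simp add: ennreal_mult)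
      finally show "G s * ennreal (b s) \<le> ennreal (C * b1)" by (simp add: b[OF s])
    qed (use b s b1 C in auto)
    have at: "0 < a t" "0 < b t" using a b t by auto
    define \<theta> where "\<theta> = a t / b t"
    have \<theta>: "0 < \<theta>" "b t / a t = 1 / \<theta>" using at by (auto simp: \<theta>_def)
    have R0: "enn_powr (\<integral>\<^sup>+ s \<in> {0<..<t}. enn_powr (osc M f s) p0 * w0 s \<partial>lebesgue) (1 / p0) \<le>
      ennreal ((2 * c0) powr (1 / p0)) * (ennreal b0 + ennreal (\<theta> * b1))"
    proof (rule enn_powr_root_le[OF p0])
      have "(\<integral>\<^sup>+ s \<in> {0<..<t}. enn_powr (osc M f s) p0 * w0 s \<partial>lebesgue) =
          (\<integral>\<^sup>+ s \<in> {0<..<t}. enn_powr (osc_mass M f s) p0 * v0 s \<partial>lebesgue)"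
        unfolding v0_def using p0 fin by (intro nn_integral_osc_eq) auto
      also have "\<dots> \<le> ennreal ((2 * 3) powr p0) * (\<integral>\<^sup>+ s \<in> {0<..<t}. enn_powr (N s) p0 * v0 s \<partial>lebesgue) +
          ennreal ((2 * 2) powr p0) * (\<integral>\<^sup>+ s \<in> {0<..<t}. enn_powr (G s) p0 * v0 s \<partial>lebesgue)"
        by (rule nn_integral_enn_powr_add_le[OF p0]) (auto intro: osc_le simp del: ennreal_numeral)
      also have "\<dots> \<le> ennreal (6 powr p0) * ennreal (E * b0 powr p0) +
          ennreal (4 powr p0) * ennreal (K0 * (a t / b t * (C * b1)) powr p0)"
      proof (intro add_mono mult_mono)
        show "(\<integral>\<^sup>+ s \<in> {0<..<t}. enn_powr (N s) p0 * v0 s \<partial>lebesgue) \<le> ennreal (E * b0 powr p0)"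
          by (rule order_trans[OF _ N_int]) (auto intro!: nn_integral_mono split: split_indicator)
        show "(\<integral>\<^sup>+ s \<in> {0<..<t}. enn_powr (G s) p0 * v0 s \<partial>lebesgue) \<le>
            ennreal (K0 * (a t / b t * (C * b1)) powr p0)"
          unfolding K0_def
          by (rule nn_integral_near_0_le[OF _ p0 \<epsilon> K tail0 _ qm _ G_le t]) (use b C b1 in auto)
      qed auto
      also have "\<dots> = ennreal (6 powr p0 * (E * b0 powr p0) + 4 powr p0 * (K0 * (a t / b t * (C * b1)) powr p0))"
        using E K0 by (simp add: ennreal_mult[symmetric] ennreal_plus[symmetric] del: ennreal_plus)
      also have "\<dots> \<le> ennreal (c0 * (b0 powr p0 + (\<theta> * b1) powr p0))"
      proof (rule ennreal_leI)
        have "(a t / b t * (C * b1)) powr p0 = C powr p0 * (\<theta> * b1) powr p0"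
          using C b1 \<theta> by (simp add: \<theta>_def[symmetric] powr_mult)
        then have "6 powr p0 * (E * b0 powr p0) + 4 powr p0 * (K0 * (a t / b t * (C * b1)) powr p0) =
          6 powr p0 * E * b0 powr p0 + 4 powr p0 * (K0 * C powr p0) * (\<theta> * b1) powr p0" by simp
        also have "\<dots> \<le> c0 * b0 powr p0 + c0 * (\<theta> * b1) powr p0"
          using E K0 by (intro add_mono mult_right_mono) (auto simp: c0_def)
        finally show "6 powr p0 * (E * b0 powr p0) + 4 powr p0 * (K0 * (a t / b t * (C * b1)) powr p0)
          \<le> c0 * (b0 powr p0 + (\<theta> * b1) powr p0)" by (simp add: distrib_left)
      qed
      also have "\<dots> = ennreal c0 * (enn_powr (ennreal b0) p0 + enn_powr (ennreal (\<theta> * b1)) p0)"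
        using c b0 b1 \<theta> by (subst ennreal_mult) (auto simp: enn_powr_ennreal)
      finally show "(\<integral>\<^sup>+ s \<in> {0<..<t}. enn_powr (osc M f s) p0 * w0 s \<partial>lebesgue) \<le>
        ennreal c0 * (enn_powr (ennreal b0) p0 + enn_powr (ennreal (\<theta> * b1)) p0)" .
    qed (use c in auto)
    have R1: "enn_powr (\<integral>\<^sup>+ s \<in> {t<..}. enn_powr (osc M f s) p1 * w1 s \<partial>lebesgue) (1 / p1) \<le>
      ennreal ((2 * c1) powr (1 / p1)) * (ennreal (1 / \<theta> * b0) + ennreal b1)"
    proof (rule enn_powr_root_le[OF p1])
      have "(\<integral>\<^sup>+ s \<in> {t<..}. enn_powr (osc M f s) p1 * w1 s \<partial>lebesgue) =
          (\<integral>\<^sup>+ s \<in> {t<..}. enn_powr (osc_mass M f s) p1 * v1 s \<partial>lebesgue)"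
        unfolding v1_def using p1 fin t by (intro nn_integral_osc_eq) auto
      also have "\<dots> \<le> ennreal ((2 * 3) powr p1) * (\<integral>\<^sup>+ s \<in> {t<..}. enn_powr (N s) p1 * v1 s \<partial>lebesgue) +
          ennreal ((2 * 2) powr p1) * (\<integral>\<^sup>+ s \<in> {t<..}. enn_powr (G s) p1 * v1 s \<partial>lebesgue)"
        by (rule nn_integral_enn_powr_add_le[OF p1]) (use t in \<open>auto intro!: osc_le simp del: ennreal_numeral\<close>)
      also have "\<dots> \<le> ennreal (6 powr p1) * ennreal (K1 * (b t / a t * (E powr (1 / p0) * b0)) powr p1) +
          ennreal (4 powr p1) * ennreal (C powr p1 * b1 powr p1)"
      proof (intro add_mono mult_mono)
        show "(\<integral>\<^sup>+ s \<in> {t<..}. enn_powr (N s) p1 * v1 s \<partial>lebesgue) \<le>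
            ennreal (K1 * (b t / a t * (E powr (1 / p0) * b0)) powr p1)"
          unfolding K1_def \<delta>_def
          by (rule nn_integral_near_infinity_le[OF _ p1 \<epsilon> K _ tail1 qm _ N_le t]) (use a b0 in auto)
        have "(\<integral>\<^sup>+ s \<in> {t<..}. enn_powr (G s) p1 * v1 s \<partial>lebesgue) \<le>
            (\<integral>\<^sup>+ s \<in> {0<..}. enn_powr (G s) p1 * v1 s \<partial>lebesgue)"
          using t by (intro nn_integral_Ioi_le) simp
        also have "\<dots> \<le> ennreal (C powr p1) *
            (\<integral>\<^sup>+ s \<in> {0<..}. enn_powr (osc_mass M f1 s) p1 * v1 s \<partial>lebesgue)"
          unfolding G_def
        \<comment> \<open>The dilation by 2 is paid for with the doubling constant of \<psi>1 to the
          power p1.\<close>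
        proof (rule nn_integral_mono_dilation_le[where F = "\<lambda>s. enn_powr (osc_mass M f1 s) p1"])
          show "mono (\<lambda>s. enn_powr (osc_mass M f1 s) p1)"
            by (intro monoI enn_powr_mono p1 monoD[OF osc_mass_mono])
        qed (auto intro: dbl_tail)
        also have "\<dots> = ennreal (C powr p1 * b1 powr p1)"
          using S1(5) b1 unfolding v1_def by (simp add: enn_powr_ennreal ennreal_mult)
        finally show "(\<integral>\<^sup>+ s \<in> {t<..}. enn_powr (G s) p1 * v1 s \<partial>lebesgue) \<le> ennreal (C powr p1 * b1 powr p1)" .
      qed auto
      also have "\<dots> = ennreal (6 powr p1 * (K1 * (b t / a t * (E powr (1 / p0) * b0)) powr p1)
          + 4 powr p1 * (C powr p1 * b1 powr p1))"
        using K1 by (simp add: ennreal_mult[symmetric] ennreal_plus[symmetric] del: ennreal_plus)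
      also have "\<dots> \<le> ennreal (c1 * ((1 / \<theta> * b0) powr p1 + b1 powr p1))"
      proof (rule ennreal_leI)
        have "(b t / a t * (E powr (1 / p0) * b0)) powr p1 = (E powr (1 / p0) * (1 / \<theta> * b0)) powr p1"
          by (simp add: \<theta>(2) mult_ac)
        also have "\<dots> = (E powr (1 / p0)) powr p1 * (1 / \<theta> * b0) powr p1"
          by (rule powr_mult)
        finally have "6 powr p1 * (K1 * (b t / a t * (E powr (1 / p0) * b0)) powr p1) + 4 powr p1 * (C powr p1 * b1 powr p1) =
          6 powr p1 * (K1 * (E powr (1 / p0)) powr p1) * (1 / \<theta> * b0) powr p1 + 4 powr p1 * C powr p1 * b1 powr p1"
          by (simp only: mult.assoc)
        also have "\<dots> \<le> c1 * (1 / \<theta> * b0) powr p1 + c1 * b1 powr p1"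
          using K1 by (intro add_mono mult_right_mono) (auto simp: c1_def)
        finally show "6 powr p1 * (K1 * (b t / a t * (E powr (1 / p0) * b0)) powr p1) + 4 powr p1 * (C powr p1 * b1 powr p1)
          \<le> c1 * ((1 / \<theta> * b0) powr p1 + b1 powr p1)" by (simp only: distrib_left)
      qed
      also have "\<dots> = ennreal c1 * (enn_powr (ennreal (1 / \<theta> * b0)) p1 + enn_powr (ennreal b1) p1)"
        using c b0 b1 \<theta> by (subst ennreal_mult) (auto simp: enn_powr_ennreal)
      finally show "(\<integral>\<^sup>+ s \<in> {t<..}. enn_powr (osc M f s) p1 * w1 s \<partial>lebesgue) \<le>
        ennreal c1 * (enn_powr (ennreal (1 / \<theta> * b0)) p1 + enn_powr (ennreal b1) p1)" .
    qed (use c in auto)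
    have \<theta>_eq: "theta p0 w0 p1 w1 t = ennreal \<theta>" using theta[OF t] by (simp add: \<theta>_def)
    \<comment> \<open>Multiplication by \<theta> turns b0 / \<theta> + b1 into b0 + \<theta> b1, the
      expression that bounds the other integral in \<open>R0\<close>.\<close>
    have "ennreal \<theta> * enn_powr (\<integral>\<^sup>+ s \<in> {t<..}. enn_powr (osc M f s) p1 * w1 s \<partial>lebesgue) (1 / p1) \<le>
      ennreal \<theta> * (ennreal ((2 * c1) powr (1 / p1)) * (ennreal (1 / \<theta> * b0) + ennreal b1))"
      by (intro mult_left_mono R1) simp
    also have "\<dots> = ennreal ((2 * c1) powr (1 / p1)) * (ennreal b0 + ennreal (\<theta> * b1))"
      using \<theta> b0 b1 by (simp add: ennreal_mult[symmetric] ennreal_plus[symmetric] distrib_left mult_ac del: ennreal_plus)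
    finally have "enn_powr (\<integral>\<^sup>+ s \<in> {0<..<t}. enn_powr (osc M f s) p0 * w0 s \<partial>lebesgue) (1 / p0)
      + ennreal \<theta> * enn_powr (\<integral>\<^sup>+ s \<in> {t<..}. enn_powr (osc M f s) p1 * w1 s \<partial>lebesgue) (1 / p1) \<le>
      ennreal ((2 * c0) powr (1 / p0)) * (ennreal b0 + ennreal (\<theta> * b1)) +
      ennreal ((2 * c1) powr (1 / p1)) * (ennreal b0 + ennreal (\<theta> * b1))"
      by (intro add_mono R0)
    also have "\<dots> = ennreal B * (ennreal b0 + ennreal (\<theta> * b1))"
      by (simp add: B_def distrib_right)
    finally show "enn_powr (\<integral>\<^sup>+ s \<in> {0<..<t}. enn_powr (osc M f s) p0 * w0 s \<partial>lebesgue) (1 / p0)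
      + theta p0 w0 p1 w1 t * enn_powr (\<integral>\<^sup>+ s \<in> {t<..}. enn_powr (osc M f s) p1 * w1 s \<partial>lebesgue) (1 / p1)
      \<le> ennreal B * (S_norm M p0 w0 f0 + theta p0 w0 p1 w1 t * S_norm M p1 w1 f1)"
      using \<theta> b1 by (simp add: \<theta>_eq b0(1) b1(1) ennreal_mult)
  qed
qed

text \<open>If \<open>\<psi>\<^sub>0\<close> is infinite, then so is \<open>\<theta>\<close>, and the first space contains only functions with \<open>f\<^sup>* = 0\<close>.\<close>

lemma S_norm_sum_ge_of_psi_top:
  assumes p0: "0 < p0" and p1: "0 < p1" and w0: "weight w0" and w1: "weight w1"
    and psi0: "\<And>t. 0 < t \<Longrightarrow> psi p0 w0 t = top"
    and psi1: "\<And>t. 0 < t \<Longrightarrow> 0 < psi p1 w1 t \<and> psi p1 w1 t < \<infinity>"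
    and f0: "f0 \<in> S_space M p0 w0" and f1: "f1 \<in> S_space M p1 w1"
    and dec: "decomposes M f f0 f1" and t: "0 < t"
  shows "enn_powr (\<integral>\<^sup>+ s \<in> {0<..<t}. enn_powr (osc M f s) p0 * w0 s \<partial>lebesgue) (1 / p0)
      + theta p0 w0 p1 w1 t * enn_powr (\<integral>\<^sup>+ s \<in> {t<..}. enn_powr (osc M f s) p1 * w1 s \<partial>lebesgue) (1 / p1)
      \<le> S_norm M p0 w0 f0 + theta p0 w0 p1 w1 t * S_norm M p1 w1 f1"
proof (cases "S_norm M p1 w1 f1 = 0")
  case False
  have "theta p0 w0 p1 w1 t = top"
    using psi0[OF t] psi1[OF t] by (auto simp: theta_def ennreal_top_divide)
  with False show ?thesis by simp
next
  case True
  note S0 = S_spaceD[OF f0 p0] and S1 = S_spaceD[OF f1 p1]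
  note f = decomposes_sum[OF S0(1,3) S1(1,3) dec]
  have fin: "rearrangement M f s < \<infinity>" if "0 < s" for s
    using rearrangement_less_top[OF f that] .
  have G1: "osc_mass M f1 s = 0" if s: "0 < s" for s
    using osc_mass_mult_psi_le[OF f1 p1 w1 s] True psi1[OF s] by auto
  \<comment> \<open>A finite norm bounds the product of the oscillation mass with an infinite
    \<psi>0, which forces the former to vanish.\<close>
  have G0: "osc_mass M f0 s = 0" if s: "0 < s" for s
    using osc_mass_mult_psi_le[OF f0 p0 w0 s] S0(2) psi0[OF s]
    by (auto simp: ennreal_mult_top top_unique split: if_splits)
  \<comment> \<open>Zero oscillation alone would permit a constant rearrangement; decay at infinity
    excludes it through the telescoping series.\<close>
  have R0: "ennreal s * rearrangement M f0 s = 0" if s: "0 < s" for s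
  proof -
    have "ennreal s * rearrangement M f0 s \<le> (\<Sum>k. ennreal ((1 / 2) ^ k) * osc_mass M f0 (2 ^ Suc k * s))"
      by (rule dyadic_telescope_le[OF rearrangement_doubling_le S0(3) s])
    also have "\<dots> = 0" using s by (simp add: G0)
    finally show ?thesis by simp
  qed
  have "osc_mass M f s = 0" if s: "0 < s" for s
    using osc_mass_add_le[OF S0(1) S1(1) f(1) dec s S0(4) fin] rearrangement_mass_le[OF s, of M f0] G0[OF s] R0[OF s]
      G1[of "2 * s"] s by simp
  then have osc: "osc M f s = 0" if "0 < s" for s
    using osc_eq[OF that fin[OF that]] that by simp
  have "(\<integral>\<^sup>+ s \<in> {0<..<t}. enn_powr (osc M f s) p0 * w0 s \<partial>lebesgue) = (\<integral>\<^sup>+ s. 0 \<partial>(lebesgue :: real measure))"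
    by (intro nn_integral_cong) (auto simp: osc split: split_indicator)
  moreover have "(\<integral>\<^sup>+ s \<in> {t<..}. enn_powr (osc M f s) p1 * w1 s \<partial>lebesgue) = (\<integral>\<^sup>+ s. 0 \<partial>(lebesgue :: real measure))"
    using t by (intro nn_integral_cong) (auto simp: osc split: split_indicator)
  ultimately show ?thesis by simp
qed

theorem theorem1p4:
  fixes M :: "'a measure"
    and p0 p1 :: real
    and w0 w1 :: "real \<Rightarrow> ennreal"
  assumes "sigma_finite_measure M" and "nonatomic M" and "0 < emeasure M (space M)"
    and "0 < p0" and "0 < p1"
    and "weight w0" and "weight w1"
    and "(psi p0 w0 \<longlongrightarrow> \<infinity>) (at_right 0)" and "(psi p1 w1 \<longlongrightarrow> \<infinity>) (at_right 0)"
    and "\<exists>C::real. C > 0 \<and> (\<forall>t>0. psi p0 w0 t \<le> ennreal C * psi p0 w0 (2 * t)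
                             \<and> psi p1 w1 t \<le> ennreal C * psi p1 w1 (2 * t))"
    and "\<forall>t>0. psi p1 w1 t < \<infinity>"
    and "RB p0 w0"
    and "\<exists>\<epsilon>::real. \<epsilon> > 0 \<and> (\<exists>h :: real \<Rightarrow> ennreal. mono_on {0<..} h \<and>
           equivalent_on {0<..} (\<lambda>t. theta p0 w0 p1 w1 t * enn_powr (psi p0 w0 t) \<epsilon>) h)"
  shows "equivalent_on (sum_space M (S_space M p0 w0) (S_space M p1 w1) \<times> {0<..})
           (\<lambda>(f, t). S_K_functional M p0 w0 p1 w1 f (theta p0 w0 p1 w1 t))
           (\<lambda>(f, t).
              enn_powr (\<integral>\<^sup>+ s \<in> {0<..<t}. enn_powr (osc M f s) p0 * w0 s \<partial>lebesgue) (1 / p0)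
            + theta p0 w0 p1 w1 t *
              enn_powr (\<integral>\<^sup>+ s \<in> {t<..}. enn_powr (osc M f s) p1 * w1 s \<partial>lebesgue) (1 / p1))"
proof -
  note p0 = assms(4) and p1 = assms(5) and w0 = assms(6) and w1 = assms(7)
  define \<theta> where "\<theta> = theta p0 w0 p1 w1"
  define rhs where "rhs f t = enn_powr (\<integral>\<^sup>+ s \<in> {0<..<t}. enn_powr (osc M f s) p0 * w0 s \<partial>lebesgue) (1 / p0)
    + \<theta> t * enn_powr (\<integral>\<^sup>+ s \<in> {t<..}. enn_powr (osc M f s) p1 * w1 s \<partial>lebesgue) (1 / p1)" for f t
  obtain C :: real where C: "0 < C"
    and dbl0: "\<And>t. 0 < t \<Longrightarrow> psi p0 w0 t \<le> ennreal C * psi p0 w0 (2 * t)"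
    and dbl1: "\<And>t. 0 < t \<Longrightarrow> psi p1 w1 t \<le> ennreal C * psi p1 w1 (2 * t)"
    using assms(10) by blast
  have pos0: "0 < psi p0 w0 t" if "0 < t" for t by (rule psi_pos[OF assms(8) dbl0 that])
  have psi1: "0 < psi p1 w1 t \<and> psi p1 w1 t < \<infinity>" if "0 < t" for t
    using psi_pos[OF assms(9) dbl1 that] assms(11) that by blast
  obtain \<epsilon> :: real and h :: "real \<Rightarrow> ennreal" and D :: real where \<epsilon>: "0 < \<epsilon>" and h: "mono_on {0<..} h" and D: "0 < D"
    and h1: "\<And>t. 0 < t \<Longrightarrow> \<theta> t * enn_powr (psi p0 w0 t) \<epsilon> \<le> ennreal D * h t"
    and h2: "\<And>t. 0 < t \<Longrightarrow> h t \<le> ennreal D * (\<theta> t * enn_powr (psi p0 w0 t) \<epsilon>)"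
    using assms(13) unfolding equivalent_on_def \<theta>_def by auto
  \<comment> \<open>Passing to h and back costs a factor D each way.\<close>
  have quasi: "\<theta> s * enn_powr (psi p0 w0 s) \<epsilon> \<le> ennreal (D * D) * (\<theta> t * enn_powr (psi p0 w0 t) \<epsilon>)"
    if "0 < s" "s \<le> t" for s t
  proof -
    have "\<theta> s * enn_powr (psi p0 w0 s) \<epsilon> \<le> ennreal D * h s" using that by (intro h1)
    also have "\<dots> \<le> ennreal D * h t" using that by (intro mult_left_mono mono_onD[OF h]) auto
    also have "\<dots> \<le> ennreal D * (ennreal D * (\<theta> t * enn_powr (psi p0 w0 t) \<epsilon>))"
      using that by (intro mult_left_mono h2) auto
    finally show ?thesis using D by (simp add: ennreal_mult mult.assoc)
  qed
  obtain B :: real where B: "0 < B" and lower: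
    "\<And>f f0 f1 t. f0 \<in> S_space M p0 w0 \<Longrightarrow> f1 \<in> S_space M p1 w1 \<Longrightarrow> decomposes M f f0 f1 \<Longrightarrow> 0 < t \<Longrightarrow>
      rhs f t \<le> ennreal B * (S_norm M p0 w0 f0 + \<theta> t * S_norm M p1 w1 f1)"
  \<comment> \<open>By \<open>psi_top\<close> the function \<psi>0 is infinite everywhere or
    nowhere, so the real-valued estimates cover the whole second case.\<close>
  proof (cases "\<exists>s>0. psi p0 w0 s = top")
    case True
    then have "psi p0 w0 t = top" if "0 < t" for t
      using psi_top[OF p0 dbl0 _ _ that] by blast
    from S_norm_sum_ge_of_psi_top[OF p0 p1 w0 w1 this psi1] show ?thesis
      by (intro that[of 1]) (auto simp: rhs_def \<theta>_def)
  next
    case False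
    then have psi0: "0 < psi p0 w0 t \<and> psi p0 w0 t < \<infinity>" if "0 < t" for t
      using pos0[OF that] that by (auto simp: less_top)
    have DD: "0 < D * D" using D by simp
    show ?thesis
      by (rule S_norm_sum_ge[where M = M, OF p0 p1 w0 w1 psi0 psi1 C dbl1 assms(12) \<epsilon> DD quasi[unfolded \<theta>_def]])
        (assumption | rule that[unfolded rhs_def \<theta>_def])+
  qed
  define A where "A = 2 powr (1 / p0) + 1 + B"
  have A: "0 < A" "B \<le> A" "2 powr (1 / p0) + 1 \<le> A" using B by (auto simp: A_def add_nonneg_pos)
  have "S_K_functional M p0 w0 p1 w1 f (\<theta> t) \<le> ennreal A * rhs f t \<and>
      rhs f t \<le> ennreal A * S_K_functional M p0 w0 p1 w1 f (\<theta> t)"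
    if f: "f \<in> sum_space M (S_space M p0 w0) (S_space M p1 w1)" and t: "0 < t" for f t
  proof
    obtain f0 f1 where f01: "f0 \<in> S_space M p0 w0" "f1 \<in> S_space M p1 w1" "decomposes M f f0 f1"
      using f unfolding sum_space_def by blast
    note meas = decomposes_sum[OF S_spaceD(1,3)[OF f01(1) p0] S_spaceD(1,3)[OF f01(2) p1] f01(3)]
    have "S_K_functional M p0 w0 p1 w1 f (\<theta> t) \<le> ennreal (2 powr (1 / p0) + 1) * rhs f t"
      unfolding \<theta>_def rhs_def
      using S_K_functional_le[OF p0 p1 w0 w1 meas t pos0[OF t]] psi1[OF t] by simp
    also have "\<dots> \<le> ennreal A * rhs f t"
      using A by (intro mult_right_mono ennreal_leI) auto
    finally show "S_K_functional M p0 w0 p1 w1 f (\<theta> t) \<le> ennreal A * rhs f t" .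
    \<comment> \<open>B is moved to the left so that the infimum receives a lower bound common to
      all decompositions.\<close>
    have "rhs f t / ennreal B \<le> S_K_functional M p0 w0 p1 w1 f (\<theta> t)"
      unfolding S_K_functional_def
    proof (rule Inf_greatest, safe)
      fix g0 g1 assume "g0 \<in> S_space M p0 w0" "g1 \<in> S_space M p1 w1" "decomposes M f g0 g1"
      then show "rhs f t / ennreal B \<le> S_norm M p0 w0 g0 + \<theta> t * S_norm M p1 w1 g1"
        using lower[of g0 g1 f t] t B by (intro divide_le_posI_ennreal) (auto simp: mult.commute)
    qed
    then have "ennreal B * (rhs f t / ennreal B) \<le> ennreal B * S_K_functional M p0 w0 p1 w1 f (\<theta> t)"
      by (rule mult_left_mono) simp
    also have "ennreal B * (rhs f t / ennreal B) = rhs f t"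
      using B by (simp add: ennreal_times_divide mult.commute[of "ennreal B"] mult_divide_eq_ennreal)
    also have "ennreal B * S_K_functional M p0 w0 p1 w1 f (\<theta> t) \<le> ennreal A * S_K_functional M p0 w0 p1 w1 f (\<theta> t)"
      using A by (intro mult_right_mono ennreal_leI) auto
    finally show "rhs f t \<le> ennreal A * S_K_functional M p0 w0 p1 w1 f (\<theta> t)" .
  qed
  then show ?thesis
    unfolding equivalent_on_def rhs_def \<theta>_def using A(1) by (intro exI[of _ A]) auto
qed

end
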